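(* Let $d\ge 1$, let $c:\mathbb{Z}^d\to\mathbb{Z}$ be a $d$-dimensional configuration (i.e. $c$ takes only finitely many values), and let $k\in\{1,\ldots,d\}$. Assume that for every $(k-1)$-dimensional linear subspace $V\subseteq\mathbb{R}^d$ the configuration $c$ has a periodizer $f$ such that $\mathrm{supp}(f)\cap V=\{\vec 0\}$. Then there exist finitely many $k$-periodic functions $c_1,\ldots,c_m\in\mathbb{Z}^{\mathbb{Z}^d}$ such that $c=c_1+\cdots+c_m$.
   Context: A function $c:\mathbb{Z}^d\to\mathbb{C}$ is identified with the formal power series $\sum_{\mathbf u\in\mathbb{Z}^d}c(\mathbf u)X^{\mathbf u}$ in variables $X=(x_1,\ldots,x_d)$, $X^{\mathbf u}=x_1^{u_1}\cdots x_d^{u_d}$. "Polynomial" means a Laurent polynomial $f=\sum_{i=1}^n f_iX^{\mathbf u_i}$ with integer coefficients; its support is $\mathrm{supp}(f)=\{\mathbf u: f_{\mathbf u}\ne0\}$. The product $fc$ is the function $\mathbf u\mapsto\sum_{i}f_i\,c(\mathbf u-\mathbf u_i)$ (discrete convolution). A vector $\mathbf v\in\mathbb{Z}^d$ is a period of $c$ if $c(\mathbf u+\mathbf v)=c(\mathbf u)$ for all $\mathbf u$; $c$ is $k$-periodic if it has $k$ linearly independent periods, and strongly periodic if it is $d$-periodic. A polynomial $f$ is a periodizer of $c$ if $fc$ is strongly periodic. *)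

theory Defs
  imports "HOL-Analysis.Analysis" "HOL-Library.Poly_Mapping"
begin

text \<open>
  The type \<open>'d\<close> indexes the coordinates, so \<open>int ^ 'd\<close> is the lattice \<open>\<int>\<^sup>d\<close> with
  \<open>d = CARD('d)\<close>. Exponents may be negative, hence finitely supported functions on
  \<open>int ^ 'd\<close> are Laurent polynomials; their support is \<^const>\<open>Poly_Mapping.keys\<close>.
\<close>

type_synonym 'd laurent_poly = "(int ^ 'd) \<Rightarrow>\<^sub>0 int"

definition real_vec :: "int ^ 'd \<Rightarrow> real ^ 'd" where
  "real_vec v = (\<chi> i. real_of_int (v $ i))"

lemma inj_real_vec: "inj real_vec"
  by (auto simp: inj_def real_vec_def vec_eq_iff)

definition configuration :: "(int ^ 'd \<Rightarrow> 'a) \<Rightarrow> bool" where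
  "configuration c \<longleftrightarrow> finite (range c)"

definition conv :: "'d::finite laurent_poly \<Rightarrow> (int ^ 'd \<Rightarrow> 'a) \<Rightarrow> int ^ 'd \<Rightarrow> 'a::comm_ring_1" where
  "conv f c u = (\<Sum>v \<in> Poly_Mapping.keys f. of_int (Poly_Mapping.lookup f v) * c (u - v))"

definition is_period :: "(int ^ 'd \<Rightarrow> 'a) \<Rightarrow> int ^ 'd \<Rightarrow> bool" where
  "is_period c v \<longleftrightarrow> (\<forall>u. c (u + v) = c u)"

text \<open>
  Linear independence is that of \<open>real ^ 'd\<close>. As \<^const>\<open>real_vec\<close> is injective, no two
  elements of \<open>B\<close> are identified in the image.
\<close>

definition k_periodic :: "nat \<Rightarrow> (int ^ 'd::finite \<Rightarrow> 'a) \<Rightarrow> bool" where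
  "k_periodic k c \<longleftrightarrow>
     (\<exists>B. finite B \<and> card B = k \<and> (\<forall>v\<in>B. is_period c v) \<and> independent (real_vec ` B))"

definition strongly_periodic :: "(int ^ 'd::finite \<Rightarrow> 'a) \<Rightarrow> bool" where
  "strongly_periodic c \<longleftrightarrow> k_periodic CARD('d) c"

definition periodizer :: "'d::finite laurent_poly \<Rightarrow> (int ^ 'd \<Rightarrow> 'a::comm_ring_1) \<Rightarrow> bool" where
  "periodizer f c \<longleftrightarrow> strongly_periodic (conv f c)"

end

theory Submission
  imports Defs "HOL-Computational_Algebra.Primes"
begin

text \<open>
  Write \<open>\<Delta>\<^sub>v c = c - X\<^sup>v c\<close>. If \<open>fc\<close> is \<open>w\<close>-periodic then \<open>f(X)\<^sup>p \<equiv> f(X\<^sup>p)\<close> modulo a large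
  prime \<open>p\<close> and the boundedness of \<open>c\<close> show that \<open>f(X\<^sup>p)c\<close> is \<open>w\<close>-periodic as well. This holds
  for all exponents \<open>r = 1 + jM\<close> in place of \<open>p\<close>, and eliminating the monomials of \<open>f\<close> other than
  the constant one (a Vandermonde argument) gives, for every \<open>(k-1)\<close>-dimensional \<open>V\<close>, a product
  of operators \<open>\<Delta>\<^sub>v\<close> with all \<open>v \<notin> V\<close> that annihilates \<open>c\<close>.

  Starting from the zero lattice and repeatedly adjoining the vectors \<open>v\<close> obtained for a
  subspace \<open>V\<close> that contains the current lattice, one obtains finitely many lattices
  \<open>L\<^sub>1, \<dots>, L\<^sub>m\<close> of rank \<open>k\<close> such that \<open>\<Delta>\<^bsub>v\<^sub>1\<^esub> \<cdots> \<Delta>\<^bsub>v\<^sub>m\<^esub> c = 0\<close> for every choice of \<open>v\<^sub>i \<in> L\<^sub>i\<close>.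
  Because \<open>c\<close> is bounded, \<open>\<Delta>\<^sub>v \<Delta>\<^sub>v b = 0\<close> implies \<open>\<Delta>\<^sub>v b = 0\<close> for all the functions \<open>b\<close> involved, so the
  \<open>L\<^sub>i\<close> may be assumed to span distinct subspaces.

  Now take \<open>k\<close> such choices in general position, so that any \<open>k\<close> of the chosen vectors are
  independent, and so are any \<open>k + 1\<close> that do not all come from the same lattice. Picking one
  vector from each of the \<open>k\<close> products gives a transversal. The equation \<open>\<Delta>\<^sub>v y = z\<close> is solvable
  inside the joint kernel of the products whenever \<open>v\<close> lies in the span of no transversal. Splitting
  off the factors one at a time writes \<open>c\<close> as a sum of functions each of which is periodic under all
  vectors of some transversal. Boundedness plays no role in this last step.
\<close>

section \<open>Difference operators\<close>

definition fdiff :: "int ^ 'd \<Rightarrow> (int ^ 'd \<Rightarrow> int) \<Rightarrow> int ^ 'd \<Rightarrow> int" where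
  "fdiff v c u = c u - c (u - v)"

definition fdiffs :: "(int ^ 'd) list \<Rightarrow> (int ^ 'd \<Rightarrow> int) \<Rightarrow> int ^ 'd \<Rightarrow> int" where
  "fdiffs vs c = foldr fdiff vs c"

lemma fdiffs_Nil [simp]: "fdiffs [] c = c"
  by (simp add: fdiffs_def)

lemma fdiffs_Cons [simp]: "fdiffs (v # vs) c = fdiff v (fdiffs vs c)"
  by (simp add: fdiffs_def)

lemma fdiff_commute: "fdiff v (fdiff w c) = fdiff w (fdiff v c)"
  by (rule ext) (simp add: fdiff_def algebra_simps)

lemma fdiffs_fdiff: "fdiffs vs (fdiff v c) = fdiff v (fdiffs vs c)"
  by (induction vs) (simp_all, metis fdiff_commute)

lemma fdiff_add: "fdiff v (\<lambda>u. a u + b u) = (\<lambda>u. fdiff v a u + fdiff v b u)"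
  by (rule ext) (simp add: fdiff_def)

lemma fdiff_diff: "fdiff v (\<lambda>u. a u - b u) = (\<lambda>u. fdiff v a u - fdiff v b u)"
  by (rule ext) (simp add: fdiff_def)

lemma fdiff_cmult: "fdiff v (\<lambda>u. k * c u) = (\<lambda>u. k * fdiff v c u)"
  by (rule ext) (simp add: fdiff_def algebra_simps)

lemma fdiff_shift: "fdiff v (\<lambda>u. c (u + w)) = (\<lambda>u. fdiff v c (u + w))"
  by (rule ext) (simp add: fdiff_def algebra_simps)

lemma fdiff_0 [simp]: "fdiff v (\<lambda>u. 0) = (\<lambda>u. 0)"
  by (rule ext) (simp add: fdiff_def)

lemma fdiffs_0 [simp]: "fdiffs vs (\<lambda>u. 0) = (\<lambda>u. 0)"
  by (induction vs) simp_all

lemma fdiffs_add: "fdiffs vs (\<lambda>u. a u + b u) = (\<lambda>u. fdiffs vs a u + fdiffs vs b u)"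
  by (induction vs) (simp_all add: fdiff_add)

lemma fdiffs_diff: "fdiffs vs (\<lambda>u. a u - b u) = (\<lambda>u. fdiffs vs a u - fdiffs vs b u)"
  by (induction vs) (simp_all add: fdiff_diff)

lemma fdiffs_cmult: "fdiffs vs (\<lambda>u. k * c u) = (\<lambda>u. k * fdiffs vs c u)"
  by (induction vs) (simp_all add: fdiff_cmult)

lemma fdiff_eq_0_iff: "fdiff v c = (\<lambda>u. 0) \<longleftrightarrow> is_period c v"
proof
  assume "fdiff v c = (\<lambda>u. 0)"
  then have "fdiff v c (u + v) = 0" for u by simp
  then show "is_period c v" by (simp add: is_period_def fdiff_def)
next
  assume "is_period c v"
  then have "c (u - v + v) = c (u - v)" for u unfolding is_period_def by blast
  then have "fdiff v c u = 0" for u by (metis diff_add_cancel diff_self fdiff_def)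
  then show "fdiff v c = (\<lambda>u. 0)" by blast
qed

section \<open>Periodizers yield annihilating products of differences\<close>

lemma conv_superset:
  fixes c :: "int ^ 'd::finite \<Rightarrow> int"
  assumes "finite S" "Poly_Mapping.keys f \<subseteq> S"
  shows "conv f c u = (\<Sum>v\<in>S. Poly_Mapping.lookup f v * c (u - v))"
  unfolding conv_def of_int_eq_id id_apply using assms
  by (intro sum.mono_neutral_left) (auto simp: in_keys_iff)

lemma conv_add:
  fixes c :: "int ^ 'd::finite \<Rightarrow> int"
  shows "conv (f + g) c u = conv f c u + conv g c u"
proof -
  let ?S = "Poly_Mapping.keys f \<union> Poly_Mapping.keys g"
  have "Poly_Mapping.keys (f + g) \<subseteq> ?S" by (rule Poly_Mapping.keys_add)
  then show ?thesis
    by (simp add: conv_superset[of ?S] lookup_add algebra_simps sum.distrib)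
qed

lemma conv_single [simp]:
  fixes c :: "int ^ 'd::finite \<Rightarrow> int"
  shows "conv (Poly_Mapping.single v a) c u = a * c (u - v)"
  by (subst conv_superset[of "{v}"]) auto

lemma conv_0 [simp]:
  fixes c :: "int ^ 'd::finite \<Rightarrow> int"
  shows "conv 0 c u = 0"
  by (simp add: conv_def)

lemma conv_sum:
  fixes c :: "int ^ 'd::finite \<Rightarrow> int"
  shows "conv (\<Sum>i\<in>I. f i) c u = (\<Sum>i\<in>I. conv (f i) c u)"
  by (induction I rule: infinite_finite_induct) (simp_all add: conv_add)

lemma poly_mapping_sum_single:
  "f = (\<Sum>v\<in>Poly_Mapping.keys f. Poly_Mapping.single v (Poly_Mapping.lookup f v))"
proof (rule poly_mapping_eqI)
  fix w
  have "(\<Sum>v\<in>Poly_Mapping.keys f. Poly_Mapping.lookup (Poly_Mapping.single v (Poly_Mapping.lookup f v)) w)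
      = (\<Sum>v\<in>Poly_Mapping.keys f. if v = w then Poly_Mapping.lookup f v else 0)"
    by (intro sum.cong) (auto simp: lookup_single when_def)
  then show "Poly_Mapping.lookup f w = Poly_Mapping.lookup
      (\<Sum>v\<in>Poly_Mapping.keys f. Poly_Mapping.single v (Poly_Mapping.lookup f v)) w"
    by (simp add: lookup_sum in_keys_iff)
qed

text \<open>Both sides are additive in \<open>f\<close> and in \<open>g\<close>, so expansion into
  monomials reduces the claim to adding exponents. Factors of a product may therefore be applied one
  after the other, in any order.\<close>

lemma conv_mult:
  fixes c :: "int ^ 'd::finite \<Rightarrow> int"
  shows "conv (f * g) c = conv f (conv g c)"
proof
  fix u
  have single: "conv (Poly_Mapping.single v a * g) c u = a * conv g c (u - v)" for v a
  proof -
    have "Poly_Mapping.single v a * (\<Sum>w\<in>Poly_Mapping.keys g. Poly_Mapping.single w (Poly_Mapping.lookup g w))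
        = (\<Sum>w\<in>Poly_Mapping.keys g. Poly_Mapping.single (v + w) (a * Poly_Mapping.lookup g w))"
      by (simp add: sum_distrib_left mult_single)
    then have "Poly_Mapping.single v a * g
        = (\<Sum>w\<in>Poly_Mapping.keys g. Poly_Mapping.single (v + w) (a * Poly_Mapping.lookup g w))"
      unfolding poly_mapping_sum_single[symmetric] .
    then show ?thesis
      by (simp add: conv_sum) (simp add: conv_def sum_distrib_left algebra_simps)
  qed
  have "(\<Sum>v\<in>Poly_Mapping.keys f. Poly_Mapping.single v (Poly_Mapping.lookup f v)) * g
      = (\<Sum>v\<in>Poly_Mapping.keys f. Poly_Mapping.single v (Poly_Mapping.lookup f v) * g)"
    by (simp add: sum_distrib_right)
  then have "f * g = (\<Sum>v\<in>Poly_Mapping.keys f. Poly_Mapping.single v (Poly_Mapping.lookup f v) * g)"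
    unfolding poly_mapping_sum_single[symmetric] .
  then show "conv (f * g) c u = conv f (conv g c) u"
    by (simp add: conv_sum single) (simp add: conv_def)
qed

lemma conv_fdiff:
  fixes c :: "int ^ 'd::finite \<Rightarrow> int"
  shows "conv f (fdiff v c) = fdiff v (conv f c)"
  by (rule ext) (simp add: conv_def fdiff_def sum_subtractf algebra_simps)

section \<open>Congruences modulo a prime and dilated polynomials\<close>

lemma freshmans_dream_sum_cong:
  fixes a :: "'i \<Rightarrow> 'a::comm_ring_1"
  assumes "prime p"
  shows "of_nat p dvd (\<Sum>i\<in>I. a i) ^ p - (\<Sum>i\<in>I. a i ^ p)"
proof (induction I rule: infinite_finite_induct)
  case (insert i I)
  have p0: "p > 0" using assms prime_gt_0_nat by blast
  let ?x = "a i" and ?y = "\<Sum>i\<in>I. a i"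
  have "(?x + ?y) ^ p = (\<Sum>k\<le>p. of_nat (p choose k) * ?x ^ k * ?y ^ (p - k))"
    by (simp add: binomial_ring)
  also have "{..p} = insert p (insert 0 {0<..<p})" by auto
  finally have "(?x + ?y) ^ p = ?x ^ p + ?y ^ p + (\<Sum>k\<in>{0<..<p}. of_nat (p choose k) * ?x ^ k * ?y ^ (p - k))"
    using p0 by (simp add: add.assoc)
  moreover have "of_nat p dvd (\<Sum>k\<in>{0<..<p}. of_nat (p choose k) * ?x ^ k * ?y ^ (p - k))"
  proof (intro dvd_sum dvd_mult2)
    fix k assume "k \<in> {0<..<p}"
    then have "p dvd p choose k" using assms by (intro dvd_choose_prime) auto
    then show "of_nat p dvd (of_nat (p choose k) :: 'a)" by (metis dvdE dvd_triv_left of_nat_mult)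
  qed
  ultimately have "of_nat p dvd ((?x + ?y) ^ p - (?x ^ p + ?y ^ p))" by simp
  from dvd_add[OF this insert.IH] show ?case
    using insert.hyps by (simp add: algebra_simps)
qed (use assms prime_gt_0_nat in \<open>auto simp: power_0_left\<close>)

text \<open>Fermat's little theorem, by induction from 0 in both directions; each step is the
  freshman's dream for \<open>a + 1\<close>.\<close>

lemma int_dvd_power_prime_diff:
  fixes a :: int
  assumes "prime p"
  shows "int p dvd a ^ p - a"
proof -
  have step: "int p dvd (a + 1) ^ p - (a ^ p + 1)" for a :: int
    using freshmans_dream_sum_cong[OF assms, of "\<lambda>i. if i then a else 1" UNIV]
    by (simp add: UNIV_bool add.commute)
  show ?thesis
  proof (induction a rule: int_induct[of _ 0])
    case base
    then show ?case using assms prime_gt_0_nat by (simp add: power_0_left)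
  next
    case (step1 i)
    from dvd_add[OF step[of i] step1(2)] show ?case by (simp add: algebra_simps)
  next
    case (step2 i)
    from dvd_diff[OF step2(2) step[of "i - 1"]] show ?case by (simp add: algebra_simps)
  qed
qed

text \<open>This is f(X^r). The lattice carries the componentwise ring structure, in which
  \<open>of_nat r\<close> is a constant vector, so \<open>of_nat r * v\<close> is a scalar
  multiple.\<close>

definition dilate :: "nat \<Rightarrow> 'd::finite laurent_poly \<Rightarrow> 'd laurent_poly" where
  "dilate r f = (\<Sum>v\<in>Poly_Mapping.keys f. Poly_Mapping.single (of_nat r * v) (Poly_Mapping.lookup f v))"

lemma conv_dilate:
  fixes c :: "int ^ 'd::finite \<Rightarrow> int"
  shows "conv (dilate r f) c u = (\<Sum>v\<in>Poly_Mapping.keys f. Poly_Mapping.lookup f v * c (u - of_nat r * v))"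
  by (simp add: dilate_def conv_sum)

lemma single_power:
  fixes a :: "'b::comm_ring_1" and v :: "'v::comm_ring_1"
  shows "Poly_Mapping.single v a ^ n = Poly_Mapping.single (of_nat n * v) (a ^ n)"
  by (induction n) (simp_all add: mult_single algebra_simps)

lemma conv_dvd_cong:
  fixes c :: "int ^ 'd::finite \<Rightarrow> int"
  assumes "of_nat p dvd f - g"
  shows "int p dvd conv f c u - conv g c u"
proof -
  from assms obtain h where "f = g + of_nat p * h" by (metis add.commute diff_add_cancel dvdE)
  \<comment> \<open>As a polynomial the integer \<open>p\<close> is a constant monomial, so the
    summand \<open>of_nat p * h\<close> contributes \<open>p\<close> times an integer.\<close>
  moreover have "(of_nat p :: 'd laurent_poly) = Poly_Mapping.single 0 (of_nat p)" by simp
  ultimately show ?thesis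
    by (simp add: conv_add conv_mult del: single_of_nat)
qed


text \<open>The freshman's dream removes the mixed terms. On a single monomial the power
  \<open>p\<close> multiplies the exponent by \<open>p\<close> and, by Fermat, alters the
  coefficient by a multiple of \<open>p\<close>.\<close>

lemma dilate_prime_cong:
  assumes "prime p"
  shows "of_nat p dvd dilate r f ^ p - dilate (p * r) f"
proof -
  let ?K = "Poly_Mapping.keys f" and ?c = "Poly_Mapping.lookup f"
  have "of_nat p dvd dilate r f ^ p - (\<Sum>v\<in>?K. Poly_Mapping.single (of_nat r * v) (?c v) ^ p)"
    unfolding dilate_def by (rule freshmans_dream_sum_cong[OF assms])
  moreover have "of_nat p dvd (\<Sum>v\<in>?K. Poly_Mapping.single (of_nat r * v) (?c v) ^ p) - dilate (p * r) f"
    unfolding dilate_def sum_subtractf[symmetric]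
  proof (rule dvd_sum)
    fix v
    from int_dvd_power_prime_diff[OF assms, of "?c v"] obtain m where m: "?c v ^ p - ?c v = int p * m"
      by (auto simp: dvd_def)
    have "Poly_Mapping.single (of_nat r * v) (?c v) ^ p - Poly_Mapping.single (of_nat (p * r) * v) (?c v)
        = Poly_Mapping.single (of_nat (p * r) * v) (?c v ^ p - ?c v)"
      by (simp add: single_power single_diff mult.assoc)
    also have "\<dots> = Poly_Mapping.single 0 (of_nat p) * Poly_Mapping.single (of_nat (p * r) * v) m"
      by (simp add: m mult_single del: single_of_nat)
    finally show "of_nat p dvd Poly_Mapping.single (of_nat r * v) (?c v) ^ p - Poly_Mapping.single (of_nat (p * r) * v) (?c v)"
      by simp
  qed
  ultimately have "of_nat p dvd dilate r f ^ p - (\<Sum>v\<in>?K. Poly_Mapping.single (of_nat r * v) (?c v) ^ p) +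
      ((\<Sum>v\<in>?K. Poly_Mapping.single (of_nat r * v) (?c v) ^ p) - dilate (p * r) f)"
    by (rule dvd_add)
  then show ?thesis by simp
qed

lemma dilate_1 [simp]: "dilate (Suc 0) f = f"
  unfolding dilate_def by (simp flip: poly_mapping_sum_single)

text \<open>Induction over the prime factors of \<open>r = p * s\<close>. Modulo \<open>p\<close>
  the polynomial \<open>dilate r f\<close> agrees with a power of \<open>dilate s f\<close>, so the
  difference in question is a multiple of \<open>p\<close>; boundedness of \<open>c\<close> makes it
  smaller than \<open>p\<close> in absolute value, hence zero.\<close>

lemma fdiff_conv_dilate_eq_0:
  fixes c :: "int ^ 'd::finite \<Rightarrow> int"
  assumes bounded: "\<And>u. \<bar>c u\<bar> \<le> C"
    and period: "fdiff w (conv f c) = (\<lambda>u. 0)"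
    and large: "\<And>p. prime p \<Longrightarrow> p dvd r \<Longrightarrow> 2 * (\<Sum>v\<in>Poly_Mapping.keys f. \<bar>Poly_Mapping.lookup f v\<bar>) * C < int p"
    and "r > 0"
  shows "fdiff w (conv (dilate r f) c) = (\<lambda>u. 0)"
  using large \<open>r > 0\<close>
proof (induction r rule: less_induct)
  case (less r)
  let ?S = "\<Sum>v\<in>Poly_Mapping.keys f. \<bar>Poly_Mapping.lookup f v\<bar>"
  show ?case
  proof (cases "r = 1")
    case True
    then show ?thesis using period by simp
  next
    case False
    then obtain p where p: "prime p" "p dvd r" using prime_factor_nat by blast
    then obtain s where r: "r = p * s" by blast
    with less.prems have "s > 0" by simp
    moreover have "p > 1" using p prime_gt_1_nat by blast
    ultimately have "s < r" by (simp add: r)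
    with less.IH[of s] less.prems r \<open>s > 0\<close> have IH: "fdiff w (conv (dilate s f) c) = (\<lambda>u. 0)"
      by simp
    show ?thesis
    proof
      fix u
      obtain q where q: "p = Suc q" using \<open>p > 1\<close> by (metis Suc_pred' less_trans zero_less_one)
      \<comment> \<open>One of the \<open>p\<close> factors is split off and meets the difference
        first, where the induction hypothesis applies.\<close>
      have "fdiff w (conv (dilate s f ^ p) c) = conv (dilate s f ^ q) (fdiff w (conv (dilate s f) c))"
        by (simp add: q conv_fdiff conv_mult[symmetric] mult.commute)
      also have "\<dots> = (\<lambda>u. 0)" by (rule ext) (simp add: IH conv_def)
      finally have zero: "fdiff w (conv (dilate s f ^ p) c) u = 0" by simp
      have cong: "int p dvd conv (dilate s f ^ p) c x - conv (dilate r f) c x" for x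
        unfolding r by (rule conv_dvd_cong[OF dilate_prime_cong[OF p(1)]])
      from dvd_diff[OF cong[of u] cong[of "u - w"]]
      have "int p dvd fdiff w (conv (dilate s f ^ p) c) u - fdiff w (conv (dilate r f) c) u"
        by (simp add: fdiff_def algebra_simps)
      then have "int p dvd fdiff w (conv (dilate r f) c) u" by (simp add: zero)
      moreover have "\<bar>fdiff w (conv (dilate r f) c) u\<bar> < int p"
      proof -
        have "\<bar>conv (dilate r f) c x\<bar> \<le> ?S * C" for x
        proof -
          have "\<bar>conv (dilate r f) c x\<bar> \<le> (\<Sum>v\<in>Poly_Mapping.keys f. \<bar>Poly_Mapping.lookup f v * c (x - of_nat r * v)\<bar>)"
            unfolding conv_dilate by (rule sum_abs)
          also have "\<dots> \<le> (\<Sum>v\<in>Poly_Mapping.keys f. \<bar>Poly_Mapping.lookup f v\<bar> * C)"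
            by (intro sum_mono) (simp add: abs_mult bounded mult_left_mono)
          finally show ?thesis by (simp add: sum_distrib_right)
        qed
        from this[of u] this[of "u - w"] less.prems(1)[OF p] show ?thesis
          by (simp add: fdiff_def)
      qed
      ultimately show "fdiff w (conv (dilate r f) c) u = 0"
        using zdvd_imp_le by (metis abs_of_nat dvd_abs_iff linorder_not_less zero_less_abs_iff abs_0_eq)
    qed
  qed
qed

text \<open>Subtracting the identity for \<open>j\<close> at \<open>u - m * x\<close> from the one
  for \<open>Suc j\<close> at \<open>u\<close> cancels the term of \<open>x\<close> and applies
  \<open>fdiff (m * x)\<close> to \<open>b\<close>. The other terms keep their shape with new
  coefficient functions \<open>?a\<close>, so the set shrinks by one element.\<close>

lemma fdiffs_elimination:
  assumes "finite S"
    and "\<And>u j. b u + (\<Sum>v\<in>S. a v (u - of_nat j * (m * v))) = 0"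
  shows "\<exists>vs. set vs = (*) m ` S \<and> fdiffs vs b = (\<lambda>u. 0)"
  using assms
proof (induction S arbitrary: a b rule: finite_induct)
  case empty
  then show ?case by (intro exI[of _ "[]"]) (simp add: fun_eq_iff)
next
  case (insert x S)
  let ?a = "\<lambda>v u. a v (u - m * v) - a v (u - m * x)"
  have "fdiff (m * x) b u + (\<Sum>v\<in>S. ?a v (u - of_nat j * (m * v))) = 0" for u j
    using insert.prems[of u "Suc j"] insert.prems[of "u - m * x" j] insert.hyps
    by (simp add: fdiff_def sum_subtractf algebra_simps)
  from insert.IH[of "fdiff (m * x) b" ?a, OF this]
  obtain vs where "set vs = (*) m ` S" "fdiffs vs (fdiff (m * x) b) = (\<lambda>u. 0)" by blast
  then show ?case by (intro exI[of _ "(m * x) # vs"]) (simp add: fdiffs_fdiff)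
qed

section \<open>The integer lattice inside real space, and bounded functions\<close>

lemma real_vec_0 [simp]: "real_vec 0 = 0"
  by (simp add: real_vec_def vec_eq_iff)

lemma real_vec_add [simp]: "real_vec (u + v) = real_vec u + real_vec v"
  by (simp add: real_vec_def vec_eq_iff)

lemma real_vec_diff [simp]: "real_vec (u - v) = real_vec u - real_vec v"
  by (simp add: real_vec_def vec_eq_iff)

lemma real_vec_uminus [simp]: "real_vec (- v) = - real_vec v"
  by (simp add: real_vec_def vec_eq_iff)

lemma real_vec_of_nat_mult [simp]: "real_vec (of_nat n * v) = of_nat n *\<^sub>R real_vec v"
  by (simp add: real_vec_def vec_eq_iff of_nat_index)

lemma real_vec_of_int_mult [simp]: "real_vec (of_int k * v) = of_int k *\<^sub>R real_vec v"
  by (cases k rule: int_cases2) simp_all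

lemma real_vec_eq_iff [simp]: "real_vec u = real_vec v \<longleftrightarrow> u = v"
  using inj_real_vec by (auto dest: injD)

definition bounded_fun :: "(int ^ 'd \<Rightarrow> int) \<Rightarrow> bool" where
  "bounded_fun c \<longleftrightarrow> (\<exists>C. \<forall>u. \<bar>c u\<bar> \<le> C)"

lemma configuration_bounded:
  fixes c :: "int ^ 'd \<Rightarrow> int"
  assumes "configuration c"
  shows "bounded_fun c"
proof -
  have "\<bar>c u\<bar> \<le> Max (abs ` range c)" for u
    using assms by (intro Max_ge) (auto simp: configuration_def)
  then show ?thesis by (auto simp: bounded_fun_def)
qed

lemma annihilating_fdiffs:
  fixes c :: "int ^ 'd::finite \<Rightarrow> int"
  assumes "configuration c" and f: "periodizer f c" "real_vec ` Poly_Mapping.keys f \<inter> V = {0}"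
    and V: "subspace V" "dim V < CARD('d)"
  shows "\<exists>vs. (\<forall>v\<in>set vs. real_vec v \<notin> V) \<and> fdiffs vs c = (\<lambda>u. 0)"
proof -
  let ?K = "Poly_Mapping.keys f" and ?f = "Poly_Mapping.lookup f"
  obtain C where C: "\<And>u. \<bar>c u\<bar> \<le> C" using configuration_bounded[OF assms(1)] by (auto simp: bounded_fun_def)
  obtain B where B: "finite B" "card B = CARD('d)" "\<And>v. v \<in> B \<Longrightarrow> is_period (conv f c) v"
    "independent (real_vec ` B)"
    using f(1) by (auto simp: periodizer_def strongly_periodic_def k_periodic_def)
  \<comment> \<open>There are more independent periods than \<open>V\<close> has dimensions, so some
    period \<open>w\<close> lies outside \<open>V\<close>.\<close>
  have "\<not> real_vec ` B \<subseteq> V"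
  proof
    assume "real_vec ` B \<subseteq> V"
    then have "card (real_vec ` B) \<le> dim V" using B(4) by (rule independent_card_le_dim)
    moreover have "card (real_vec ` B) = card B" by (intro card_image inj_onI) simp
    ultimately show False using V(2) B(2) by simp
  qed
  then obtain w where w: "w \<in> B" "real_vec w \<notin> V" by blast
  have per: "fdiff w (conv f c) = (\<lambda>u. 0)" using B(3)[OF w(1)] by (simp add: fdiff_eq_0_iff)
  \<comment> \<open>\<open>D\<close> is the bound that primes must exceed in the dilation argument.
    All primes up to \<open>D\<close> divide the factorial \<open>M\<close>, so none of them divides
    \<open>1 + j * M\<close>.\<close>
  define D where "D = 2 * (\<Sum>v\<in>?K. \<bar>?f v\<bar>) * C"
  define M :: nat where "M = fact (nat D)"
  have "M > 0" by (simp add: M_def)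
  have zero: "fdiff w (conv (dilate (1 + j * M) f) c) = (\<lambda>u. 0)" for j
  proof (rule fdiff_conv_dilate_eq_0[OF C per])
    fix p assume p: "prime p" "p dvd 1 + j * M"
    have "\<not> p \<le> nat D"
    proof
      assume "p \<le> nat D"
      moreover have "p \<ge> 1" using p(1) prime_ge_1_nat by blast
      ultimately have "p dvd M" unfolding M_def by (intro dvd_fact)
      with p have "p dvd 1" by (metis dvd_add_left_iff dvd_mult)
      with p(1) show False by simp
    qed
    then show "2 * (\<Sum>v\<in>?K. \<bar>?f v\<bar>) * C < int p" unfolding D_def by linarith
  qed simp
  have zero_key: "0 \<in> ?K" "\<And>v. v \<in> ?K \<Longrightarrow> v \<noteq> 0 \<Longrightarrow> real_vec v \<notin> V"
  proof -
    have "0 \<in> real_vec ` ?K" using f(2) by blast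
    then show "0 \<in> ?K" by (metis imageE real_vec_0 real_vec_eq_iff)
    show "real_vec v \<notin> V" if "v \<in> ?K" "v \<noteq> 0" for v
      using f(2) that by (metis IntI imageI real_vec_0 real_vec_eq_iff singletonD)
  qed
  \<comment> \<open>Dilation by \<open>1 + j * M\<close> shifts the term of \<open>v\<close> by
    \<open>v\<close> plus \<open>j\<close> times \<open>M * v\<close>. The fixed shift goes into the
    coefficient function, leaving exactly the dependence on \<open>j\<close> that the elimination
    handles.\<close>
  have "\<exists>vs. set vs = (*) (of_nat M) ` (?K - {0}) \<and> fdiffs vs (\<lambda>u. ?f 0 * fdiff w c u) = (\<lambda>u. 0)"
  proof (rule fdiffs_elimination[where a = "\<lambda>v u. ?f v * fdiff w c (u - v)"])
    fix u j
    have "?f 0 * fdiff w c u + (\<Sum>v\<in>?K - {0}. ?f v * fdiff w c (u - of_nat j * (of_nat M * v) - v))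
        = (\<Sum>v\<in>?K. ?f v * fdiff w c (u - of_nat j * (of_nat M * v) - v))"
      using zero_key(1) by (subst (2) sum.remove[of _ 0]) auto
    also have "\<dots> = conv (dilate (1 + j * M) f) (fdiff w c) u"
      unfolding conv_dilate by (intro sum.cong) (auto simp: algebra_simps)
    also have "\<dots> = 0" by (simp only: conv_fdiff zero)
    finally show "?f 0 * fdiff w c u + (\<Sum>v\<in>?K - {0}. ?f v * fdiff w c (u - of_nat j * (of_nat M * v) - v)) = 0" .
  qed simp
  then obtain vs where vs: "set vs = (*) (of_nat M) ` (?K - {0})"
    "fdiffs vs (\<lambda>u. ?f 0 * fdiff w c u) = (\<lambda>u. 0)" by blast
  \<comment> \<open>The constant coefficient is a nonzero integer because 0 is a key, so it can be
    cancelled.\<close>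
  from vs(2) zero_key(1) have "fdiffs vs (fdiff w c) = (\<lambda>u. 0)"
    by (simp add: fdiffs_cmult fun_eq_iff in_keys_iff)
  then have "fdiffs (w # vs) c = (\<lambda>u. 0)" by (simp add: fdiffs_fdiff)
  moreover have "real_vec v \<notin> V" if "v \<in> set (w # vs)" for v
  proof (cases "v = w")
    case False
    with that vs(1) obtain x where x: "x \<in> ?K" "x \<noteq> 0" "v = of_nat M * x" by auto
    show ?thesis
    proof
      assume "real_vec v \<in> V"
      with V(1) have "(1 / real M) *\<^sub>R real_vec v \<in> V" by (rule subspace_scale)
      with x \<open>M > 0\<close> zero_key(2) show False by simp
    qed
  qed (use w in simp)
  ultimately show ?thesis by blast
qed

section \<open>Annihilation by families of lattices\<close>

text \<open>Quantifies over one vector from each set, recursively, so that inductions can process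
  one set at a time. An empty set anywhere in the list makes it hold vacuously.\<close>

fun kills :: "(int ^ 'd::finite) set list \<Rightarrow> (int ^ 'd \<Rightarrow> int) \<Rightarrow> bool" where
  "kills [] c \<longleftrightarrow> c = (\<lambda>u. 0)"
| "kills (G # Gs) c \<longleftrightarrow> (\<forall>v\<in>G. kills Gs (fdiff v c))"

lemma kills_zero: "kills Gs (\<lambda>u. 0)"
  by (induction Gs) simp_all

lemma kills_fdiff: "kills Gs c \<Longrightarrow> kills Gs (fdiff v c)"
proof (induction Gs arbitrary: c)
  case (Cons G Gs)
  then show ?case by (simp add: fdiff_commute[of _ v])
qed simp

lemma kills_add: "kills Gs a \<Longrightarrow> kills Gs b \<Longrightarrow> kills Gs (\<lambda>u. a u + b u)"
  by (induction Gs arbitrary: a b) (simp_all add: fdiff_add)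

lemma kills_cmult: "kills Gs c \<Longrightarrow> kills Gs (\<lambda>u. k * c u)"
  by (induction Gs arbitrary: c) (simp_all add: fdiff_cmult)

lemma kills_shift: "kills Gs c \<Longrightarrow> kills Gs (\<lambda>u. c (u + w))"
  by (induction Gs arbitrary: c) (simp_all add: fdiff_shift fun_eq_iff)

lemma kills_append: "kills Gs c \<Longrightarrow> kills (Hs @ Gs) c"
  by (induction Hs arbitrary: c) (simp_all add: kills_fdiff)

text \<open>A choice from the sets \<open>insert v G\<close> either takes some vector of
  \<open>G\<close>, where the first assumption applies, or takes every \<open>v\<close> itself,
  which gives the product \<open>fdiffs vs\<close>.\<close>

lemma kills_insert_append:
  assumes "\<And>x. x \<in> G \<Longrightarrow> kills Gs (fdiff x c)" and "fdiffs vs c = (\<lambda>u. 0)"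
  shows "kills (map (\<lambda>v. insert v G) vs @ Gs) c"
  using assms
proof (induction vs arbitrary: c)
  case Nil
  then show ?case by (simp add: kills_zero)
next
  case (Cons v vs)
  have "kills (map (\<lambda>v. insert v G) vs @ Gs) (fdiff v c)"
    using Cons.prems by (intro Cons.IH) (simp_all add: fdiff_commute[of _ v] kills_fdiff fdiffs_fdiff)
  then show ?case using Cons.prems(1) by (simp add: kills_append)
qed

lemma kills_refine:
  assumes "kills Gs c" and "\<And>G. G \<in> set Gs \<Longrightarrow> fdiffs (f G) c = (\<lambda>u. 0)"
  shows "kills (concat (map (\<lambda>G. map (\<lambda>v. insert v G) (f G)) Gs)) c"
  using assms
proof (induction Gs arbitrary: c)
  case (Cons G Gs)
  have "kills (concat (map (\<lambda>G. map (\<lambda>v. insert v G) (f G)) Gs)) (fdiff x c)" if "x \<in> G" for x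
    using Cons.prems that by (intro Cons.IH) (simp_all add: fdiffs_fdiff)
  with Cons.prems(2)[of G] show ?case by (simp add: kills_insert_append)
qed simp

section \<open>Raising the rank of the families\<close>

lemma subspace_of_dim_containing:
  fixes S :: "(real ^ 'd) set"
  assumes "independent S" "card S \<le> n" "n \<le> CARD('d)"
  obtains V where "subspace V" "dim V = n" "S \<subseteq> V"
proof -
  from maximal_independent_subset_extend[OF subset_UNIV assms(1)]
  obtain B where B: "S \<subseteq> B" "B \<subseteq> UNIV" "independent B" "UNIV \<subseteq> span B" .
  have fin: "finite B" using B(3) by (rule independent_imp_finite)
  have "card B = dim (UNIV :: (real ^ 'd) set)" by (rule basis_card_eq_dim[OF B(2) B(4) B(3)])
  then have "n \<le> card B" using assms(3) by simp
  from exists_subset_between[OF assms(2) this B(1) fin]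
  obtain T where T: "S \<subseteq> T" "T \<subseteq> B" "card T = n" by blast
  show ?thesis
  proof
    have "independent T" using B(3) T(2) by (rule independent_mono)
    then show "dim (span T) = n" using T(3) by (simp add: dim_eq_card_independent)
    show "S \<subseteq> span T" using T(1) span_superset by (rule order_trans)
    show "subspace (span T)" by (rule subspace_span)
  qed
qed

text \<open>Induction on the rank \<open>j\<close>. While \<open>j < k\<close>, the span of each
  \<open>G\<close> fits into a subspace \<open>V\<close> of dimension \<open>k - 1\<close>; the
  vectors annihilating for \<open>V\<close> lie outside it, so adjoining any one of them to
  \<open>G\<close> keeps independence.\<close>

lemma exists_kills_independent:
  fixes c :: "int ^ 'd::finite \<Rightarrow> int"
  assumes ann: "\<And>V. subspace V \<Longrightarrow> dim V = k - 1 \<Longrightarrow>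
      \<exists>vs. (\<forall>v\<in>set vs. real_vec v \<notin> V) \<and> fdiffs vs c = (\<lambda>u. 0)"
    and k: "k \<le> CARD('d)" and "j \<le> k"
  shows "\<exists>Gs. kills Gs c \<and> (\<forall>G\<in>set Gs. finite G \<and> card G = j \<and> independent (real_vec ` G))"
  using \<open>j \<le> k\<close>
proof (induction j)
  case 0
  show ?case
    \<comment> \<open>The list with one empty set kills everything, as it offers no vector to
      choose.\<close>
    by (intro exI[of _ "[{}]"]) (simp add: independent_empty)
next
  case (Suc j)
  then obtain Gs where Gs: "kills Gs c"
    "\<And>G. G \<in> set Gs \<Longrightarrow> finite G \<and> card G = j \<and> independent (real_vec ` G)" by auto
  have "\<exists>vs. (\<forall>v\<in>set vs. real_vec v \<notin> span (real_vec ` G)) \<and> fdiffs vs c = (\<lambda>u. 0)" if "G \<in> set Gs" for G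
  proof -
    have ind: "independent (real_vec ` G)" using Gs(2)[OF that] by blast
    have card: "card (real_vec ` G) \<le> k - 1"
      using Gs(2)[OF that] Suc.prems card_image_le[of G real_vec] by linarith
    have "k - 1 \<le> CARD('d)" using k by simp
    from subspace_of_dim_containing[OF ind card this]
    obtain V where V: "subspace V" "dim V = k - 1" "real_vec ` G \<subseteq> V" .
    then have "span (real_vec ` G) \<subseteq> V" by (simp add: span_minimal)
    with ann[OF V(1,2)] show ?thesis by blast
  qed
  then obtain f where f: "\<And>G v. G \<in> set Gs \<Longrightarrow> v \<in> set (f G) \<Longrightarrow> real_vec v \<notin> span (real_vec ` G)"
    "\<And>G. G \<in> set Gs \<Longrightarrow> fdiffs (f G) c = (\<lambda>u. 0)" by metis
  let ?Hs = "concat (map (\<lambda>G. map (\<lambda>v. insert v G) (f G)) Gs)"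
  have "finite H \<and> card H = Suc j \<and> independent (real_vec ` H)" if "H \<in> set ?Hs" for H
  proof -
    from that obtain G v where H: "G \<in> set Gs" "v \<in> set (f G)" "H = insert v G" by auto
    have "v \<notin> G" using f(1)[OF H(1,2)] span_base[of "real_vec v" "real_vec ` G"] by auto
    with Gs(2)[OF H(1)] f(1)[OF H(1,2)] show ?thesis by (simp add: H(3) independent_insertI)
  qed
  moreover have "kills ?Hs c" using Gs(1) f(2) by (rule kills_refine)
  ultimately show ?case by blast
qed

section \<open>From generators to the subgroups they generate\<close>

inductive_set zspan :: "(int ^ 'd::finite) set \<Rightarrow> (int ^ 'd) set" for B where
  zero: "0 \<in> zspan B"
| plus: "u \<in> zspan B \<Longrightarrow> b \<in> B \<Longrightarrow> u + b \<in> zspan B"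
| minus: "u \<in> zspan B \<Longrightarrow> b \<in> B \<Longrightarrow> u - b \<in> zspan B"

lemma zspan_add:
  assumes "u \<in> zspan B" "v \<in> zspan B"
  shows "u + v \<in> zspan B"
  using assms(2)
proof (induction v rule: zspan.induct)
  case (plus v b)
  from zspan.plus[OF plus.IH plus.hyps(2)] show ?case by (simp add: add.assoc)
next
  case (minus v b)
  from zspan.minus[OF minus.IH minus.hyps(2)] show ?case by (simp add: add_diff_eq)
qed (simp add: assms(1))

lemma zspan_uminus: "u \<in> zspan B \<Longrightarrow> - u \<in> zspan B"
proof (induction u rule: zspan.induct)
  case (plus v b)
  from zspan.minus[OF plus.IH plus.hyps(2)] show ?case by simp
next
  case (minus v b)
  from zspan.plus[OF minus.IH minus.hyps(2)] show ?case by simp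
qed (simp add: zspan.zero)

lemma zspan_of_nat_mult: "u \<in> zspan B \<Longrightarrow> of_nat n * u \<in> zspan B"
  by (induction n) (simp_all add: zspan.zero zspan_add algebra_simps)

lemma zspan_of_int_mult: "u \<in> zspan B \<Longrightarrow> of_int k * u \<in> zspan B"
  by (cases k rule: int_cases2) (simp_all add: zspan_of_nat_mult zspan_uminus)

lemma zspan_base: "b \<in> B \<Longrightarrow> b \<in> zspan B"
  using zspan.plus[OF zspan.zero] by fastforce

lemma zspan_sum: "(\<And>i. i \<in> I \<Longrightarrow> f i \<in> zspan B) \<Longrightarrow> (\<Sum>i\<in>I. f i) \<in> zspan B"
  by (induction I rule: infinite_finite_induct) (simp_all add: zspan.zero zspan_add)

text \<open>A difference along \<open>u + b\<close> is the difference along \<open>u\<close> plus a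
  translate of the one along \<open>b\<close>, and likewise with a sign for \<open>u - b\<close>.
  Killed functions are closed under sums, translates and multiples.\<close>

lemma kills_zspan_Cons:
  assumes "\<And>v. v \<in> B \<Longrightarrow> kills Gs (fdiff v c)" "v \<in> zspan B"
  shows "kills Gs (fdiff v c)"
  using assms(2)
proof (induction v rule: zspan.induct)
  case zero
  have "fdiff 0 c = (\<lambda>u. 0)" by (rule ext) (simp add: fdiff_def)
  then show ?case by (simp add: kills_zero)
next
  case (plus u b)
  have "fdiff (u + b) c = (\<lambda>x. fdiff u c x + fdiff b c (x + - u))"
    by (rule ext) (simp add: fdiff_def algebra_simps)
  then show ?case using plus assms(1) by (simp only: kills_add kills_shift)
next
  case (minus u b)
  have "fdiff (u - b) c = (\<lambda>x. fdiff u c x + - 1 * fdiff b c (x + (b - u)))"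
    by (rule ext) (simp add: fdiff_def algebra_simps)
  then show ?case using minus assms(1) by (simp only: kills_add kills_shift kills_cmult)
qed

lemma kills_zspan: "kills Gs c \<Longrightarrow> kills (map zspan Gs) c"
proof (induction Gs arbitrary: c)
  case (Cons G Gs)
  show ?case
    using kills_zspan_Cons[of G "map zspan Gs" c] Cons by simp
qed simp

lemma kills_antimono: "list_all2 (\<subseteq>) Hs Gs \<Longrightarrow> kills Gs c \<Longrightarrow> kills Hs c"
  by (induction arbitrary: c rule: list_all2_induct) auto

section \<open>Removing repeated lattices by boundedness\<close>

lemma bounded_fun_fdiff: "bounded_fun c \<Longrightarrow> bounded_fun (fdiff v c)"
proof -
  assume "bounded_fun c"
  then obtain C where C: "\<And>u. \<bar>c u\<bar> \<le> C" by (auto simp: bounded_fun_def)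
  have "\<bar>fdiff v c u\<bar> \<le> C + C" for u
    using C[of u] C[of "u - v"] by (simp add: fdiff_def)
  then show ?thesis by (auto simp: bounded_fun_def)
qed

text \<open>The assumption makes \<open>c\<close> affine along every line in direction
  \<open>v\<close>; a bounded affine sequence is constant.\<close>

lemma fdiff_eq_0_if_fdiff_fdiff_eq_0:
  fixes c :: "int ^ 'd::finite \<Rightarrow> int"
  assumes "bounded_fun c" "fdiff v (fdiff v c) = (\<lambda>u. 0)"
  shows "fdiff v c = (\<lambda>u. 0)"
proof
  fix u
  obtain C where C: "\<And>u. \<bar>c u\<bar> \<le> C" using assms(1) by (auto simp: bounded_fun_def)
  have per: "is_period (fdiff v c) v" using assms(2) by (simp add: fdiff_eq_0_iff)
  have const: "fdiff v c (u + of_nat n * v) = fdiff v c u" for n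
  proof (induction n)
    case (Suc n)
    have "u + of_nat (Suc n) * v = (u + of_nat n * v) + v" by (simp add: algebra_simps)
    with per Suc show ?case by (simp only: is_period_def)
  qed simp
  have lin: "c (u + of_nat n * v) = c u + int n * fdiff v c u" for n
  proof (induction n)
    case (Suc n)
    have "c (u + of_nat (Suc n) * v) - c (u + of_nat n * v) = fdiff v c u"
      using const[of "Suc n"] by (simp add: fdiff_def algebra_simps)
    with Suc show ?case by (simp add: algebra_simps)
  qed simp
  show "fdiff v c u = 0"
  proof (rule ccontr)
    assume "fdiff v c u \<noteq> 0"
    \<comment> \<open>After this many steps a nonzero integer slope changes the value by more than
      \<open>2 * C\<close>.\<close>
    define n where "n = nat (2 * C + 1)"
    have n: "int n = 2 * C + 1" using C[of u] by (simp add: n_def)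
    have "\<bar>int n * fdiff v c u\<bar> \<le> 2 * C"
      using lin[of n] C[of u] C[of "u + of_nat n * v"] by linarith
    moreover have "int n * 1 \<le> int n * \<bar>fdiff v c u\<bar>"
      using \<open>fdiff v c u \<noteq> 0\<close> by (intro mult_left_mono) auto
    moreover have "\<bar>int n * fdiff v c u\<bar> = int n * \<bar>fdiff v c u\<bar>" by (simp add: abs_mult)
    ultimately show False using n by linarith
  qed
qed

lemma kills_fdiff_if_kills_fdiff_fdiff:
  "bounded_fun c \<Longrightarrow> kills Gs (fdiff v (fdiff v c)) \<Longrightarrow> kills Gs (fdiff v c)"
proof (induction Gs arbitrary: c)
  case Nil
  then show ?case using fdiff_eq_0_if_fdiff_fdiff_eq_0[of c v] by simp
next
  case (Cons G Gs)
  have "kills Gs (fdiff x (fdiff v c))" if "x \<in> G" for x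
  proof -
    have "fdiff v (fdiff v (fdiff x c)) = fdiff x (fdiff v (fdiff v c))" by (metis fdiff_commute)
    with Cons.prems that have "kills Gs (fdiff v (fdiff v (fdiff x c)))" by simp
    with Cons.IH bounded_fun_fdiff[OF Cons.prems(1)] have "kills Gs (fdiff v (fdiff x c))" by blast
    then show ?thesis by (simp only: fdiff_commute[of v x])
  qed
  then show ?case by simp
qed

text \<open>The extra vector is taken equal to the one chosen from the occurrence of
  \<open>G\<close> in \<open>Gs\<close>; the resulting double difference collapses to a single
  one.\<close>

lemma kills_absorb:
  "bounded_fun c \<Longrightarrow> G \<in> set Gs \<Longrightarrow> \<forall>v\<in>G. kills Gs (fdiff v c) \<Longrightarrow> kills Gs c"
proof (induction Gs arbitrary: c)
  case (Cons H Gs)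
  show ?case
  proof (cases "G = H")
    case True
    with Cons.prems show ?thesis by (auto intro: kills_fdiff_if_kills_fdiff_fdiff)
  next
    case False
    have "kills Gs (fdiff x c)" if "x \<in> H" for x
      using Cons.prems False that by (intro Cons.IH bounded_fun_fdiff) (auto simp: fdiff_commute[of _ x])
    then show ?thesis by simp
  qed
qed simp

lemma kills_remdups: "bounded_fun c \<Longrightarrow> kills (map G Ws) c \<Longrightarrow> kills (map G (remdups Ws)) c"
proof (induction Ws arbitrary: c)
  case (Cons W Ws)
  then have IH: "\<forall>v\<in>G W. kills (map G (remdups Ws)) (fdiff v c)"
    by (simp add: bounded_fun_fdiff)
  then show ?case using kills_absorb[OF Cons.prems(1), of "G W" "map G (remdups Ws)"] by auto
qed simp

section \<open>Lattices that depend only on their span\<close>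

lemma real_vec_sum: "real_vec (\<Sum>i\<in>I. f i) = (\<Sum>i\<in>I. real_vec (f i))"
  by (induction I rule: infinite_finite_induct) simp_all

lemma finite_bounded_int_vec: "finite {v :: int ^ 'd::finite. \<forall>i. \<bar>v $ i\<bar> \<le> K}"
proof -
  have "finite (PiE (UNIV :: 'd set) (\<lambda>_. {-K..K}))" by (intro finite_PiE) simp_all
  moreover have "vec_nth ` {v :: int ^ 'd. \<forall>i. \<bar>v $ i\<bar> \<le> K} \<subseteq> PiE UNIV (\<lambda>_. {-K..K})"
    by (auto simp: abs_le_iff PiE_UNIV_domain) (metis minus_le_iff)
  ultimately have "finite (vec_nth ` {v :: int ^ 'd. \<forall>i. \<bar>v $ i\<bar> \<le> K})" by (rule finite_subset[rotated])
  then show ?thesis by (rule finite_imageD) (simp add: inj_on_def vec_nth_inject)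
qed

text \<open>
  Pigeonhole: the multiples of \<open>u\<close>, reduced modulo the lattice generated by \<open>B\<close>, stay in a
  bounded set of integer vectors.
\<close>

lemma of_nat_mult_in_zspan:
  assumes "finite B" "real_vec u \<in> span (real_vec ` B)"
  obtains n where "n > 0" "of_nat n * u \<in> zspan B"
proof -
  have "inj_on real_vec B" by (simp add: inj_on_def)
  obtain t0 where "real_vec u = (\<Sum>x\<in>real_vec ` B. t0 x *\<^sub>R x)"
    using assms by (auto simp: span_finite)
  also have "\<dots> = (\<Sum>b\<in>B. t0 (real_vec b) *\<^sub>R real_vec b)"
    using \<open>inj_on real_vec B\<close> by (simp add: sum.reindex)
  finally have "real_vec u = (\<Sum>b\<in>B. t0 (real_vec b) *\<^sub>R real_vec b)" .
  then obtain t where t: "real_vec u = (\<Sum>b\<in>B. t b *\<^sub>R real_vec b)" by (rule that)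
  \<comment> \<open>Rounding the coefficients of \<open>n\<close> times \<open>u\<close> down gives
    a lattice point \<open>z n\<close>; the remainder \<open>r n\<close> has coefficients in [0,1),
    which confines it to finitely many integer vectors.\<close>
  define z where "z n = (\<Sum>b\<in>B. of_int \<lfloor>of_nat n * t b\<rfloor> * b)" for n :: nat
  define r where "r n = of_nat n * u - z n" for n
  have z: "z n \<in> zspan B" for n
    unfolding z_def by (intro zspan_sum zspan_of_int_mult zspan_base)
  have r: "real_vec (r n) = (\<Sum>b\<in>B. frac (of_nat n * t b) *\<^sub>R real_vec b)" for n
    by (simp add: r_def z_def t real_vec_sum scaleR_sum_right sum_subtractf[symmetric] frac_def
        scaleR_diff_left)
  define K where "K = (\<Sum>b\<in>B. \<Sum>i\<in>UNIV. \<bar>b $ i\<bar>)"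
  have "\<bar>r n $ i\<bar> \<le> K" for n i
  proof -
    have "real_of_int (r n $ i) = (\<Sum>b\<in>B. frac (of_nat n * t b) * real_of_int (b $ i))"
      using arg_cong[OF r, of "\<lambda>x. x $ i"] by (simp add: real_vec_def)
    then have "real_of_int \<bar>r n $ i\<bar> \<le> (\<Sum>b\<in>B. \<bar>frac (of_nat n * t b) * real_of_int (b $ i)\<bar>)"
      by (simp add: sum_abs)
    also have "\<dots> \<le> (\<Sum>b\<in>B. real_of_int \<bar>b $ i\<bar>)"
      by (intro sum_mono) (simp add: abs_mult mult_left_le_one_le frac_lt_1 less_imp_le)
    also have "\<dots> = real_of_int (\<Sum>b\<in>B. \<bar>b $ i\<bar>)" by simp
    finally have "\<bar>r n $ i\<bar> \<le> (\<Sum>b\<in>B. \<bar>b $ i\<bar>)" by (simp only: of_int_le_iff)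
    also have "\<dots> \<le> K"
      unfolding K_def by (intro sum_mono member_le_sum) auto
    finally show ?thesis .
  qed
  then have "range r \<subseteq> {v. \<forall>i. \<bar>v $ i\<bar> \<le> K}" by auto
  then have "finite (range r)" using finite_bounded_int_vec finite_subset by blast
  then have "\<not> inj r" using finite_imageD infinite_UNIV_nat by blast
  then obtain m n where mn: "r m = r n" "m < n"
    by (metis injI linorder_neqE_nat)
  have "of_nat (n - m) * u = z n + - z m"
    using mn by (simp add: r_def of_nat_diff algebra_simps)
  then have "of_nat (n - m) * u \<in> zspan B" by (simp add: z zspan_add zspan_uminus del: add_uminus_conv_diff)
  with mn(2) show ?thesis by (intro that[of "n - m"]) simp_all
qed

lemma exists_kills_lattices:
  fixes c :: "int ^ 'd::finite \<Rightarrow> int"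
  assumes "bounded_fun c" and kills: "kills Gs c"
    and Gs: "\<And>G. G \<in> set Gs \<Longrightarrow> finite G \<and> card G = k \<and> independent (real_vec ` G)"
  obtains Ws L where "distinct Ws" "kills (map L Ws) c"
    "\<And>W. W \<in> set Ws \<Longrightarrow> subspace W \<and> dim W = k \<and> W \<subseteq> span (real_vec ` L W) \<and> real_vec ` L W \<subseteq> W"
    "\<And>W. W \<in> set Ws \<Longrightarrow> 0 \<in> L W"
    "\<And>W u v. W \<in> set Ws \<Longrightarrow> u \<in> L W \<Longrightarrow> v \<in> L W \<Longrightarrow> u + v \<in> L W"
proof -
  define sp where "sp G = span (real_vec ` G)" for G :: "(int ^ 'd) set"
  define L where "L W = {u. real_vec u \<in> W \<and> (\<forall>G\<in>set Gs. sp G = W \<longrightarrow> u \<in> zspan G)}" for W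
  define Ws where "Ws = remdups (map sp Gs)"
  have "L (sp G) \<subseteq> zspan G" if "G \<in> set Gs" for G using that by (auto simp: L_def)
  then have sub: "list_all2 (\<subseteq>) (map L (map sp Gs)) (map zspan Gs)"
    by (simp add: list_all2_conv_all_nth)
  have "kills (map L Ws) c"
    unfolding Ws_def using kills_remdups[OF assms(1) kills_antimono[OF sub kills_zspan[OF kills]]] .
  moreover have "subspace W \<and> dim W = k \<and> W \<subseteq> span (real_vec ` L W) \<and> real_vec ` L W \<subseteq> W" if "W \<in> set Ws" for W
  proof -
    from that obtain G where G: "G \<in> set Gs" "W = sp G" by (auto simp: Ws_def)
    have "real_vec b \<in> span (real_vec ` L W)" if "b \<in> G" for b
    proof -
      have b: "real_vec b \<in> W" using that by (simp add: G(2) sp_def span_base)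
      have "\<exists>n>0. \<forall>H\<in>\<H>. of_nat n * b \<in> zspan H"
        if "finite \<H>" "\<H> \<subseteq> {H \<in> set Gs. sp H = W}" for \<H>
        using that
      proof (induction \<H> rule: finite_induct)
        case (insert H \<H>)
        then obtain n where n: "n > 0" "\<forall>H\<in>\<H>. of_nat n * b \<in> zspan H" by auto
        have "finite H" "real_vec b \<in> span (real_vec ` H)"
          using insert.prems Gs b by (auto simp: sp_def)
        from of_nat_mult_in_zspan[OF this] obtain m where m: "m > 0" "of_nat m * b \<in> zspan H" .
        have "of_nat (m * n) * b = of_nat m * (of_nat n * b)" "of_nat (m * n) * b = of_nat n * (of_nat m * b)"
          by (simp_all add: mult.assoc mult.left_commute)
        then have "\<forall>H\<in>insert H \<H>. of_nat (m * n) * b \<in> zspan H"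
          using n(2) m(2) zspan_of_nat_mult by (metis insert_iff)
        with n(1) m(1) show ?case by (intro exI[of _ "m * n"]) simp
      qed auto
      from this[OF _ order_refl] obtain n where n: "n > 0" "\<forall>H\<in>{H \<in> set Gs. sp H = W}. of_nat n * b \<in> zspan H"
        by auto
      have "real_vec (of_nat n * b) \<in> W" using b unfolding G(2) sp_def by (simp add: span_scale)
      then have "of_nat n * b \<in> L W" using n(2) by (simp add: L_def)
      then have "real_vec (of_nat n * b) \<in> span (real_vec ` L W)" by (intro span_base imageI)
      then have "(1 / real n) *\<^sub>R real_vec (of_nat n * b) \<in> span (real_vec ` L W)" by (rule span_scale)
      with n(1) show ?thesis by simp
    qed
    then have "W \<subseteq> span (real_vec ` L W)"
      unfolding G(2) sp_def by (intro span_minimal) (auto simp: sp_def)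
    moreover have "dim W = k"
      using Gs[OF G(1)] card_image[of real_vec G]
      by (simp add: G(2) sp_def dim_eq_card_independent inj_on_def)
    ultimately show ?thesis by (auto simp: G(2) sp_def L_def)
  qed
  moreover have "u + v \<in> L W" if "W \<in> set Ws" "u \<in> L W" "v \<in> L W" for W u v
    using that by (auto simp: L_def zspan_add Ws_def sp_def span_add)
  moreover have "0 \<in> L W" if "W \<in> set Ws" for W
    using that by (auto simp: L_def Ws_def sp_def span_zero zspan.zero)
  moreover have "distinct Ws" by (simp add: Ws_def)
  ultimately show ?thesis using that[of Ws L] by blast
qed

section \<open>Vectors in general position\<close>

text \<open>Each subspace contains at most one point \<open>u + of_nat n * w\<close>: two of them
  would force first \<open>w\<close> and then \<open>u\<close> into it, while the old subspaces miss
  \<open>u\<close> and the new one misses \<open>w\<close>.\<close>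

lemma exists_avoiding_subspaces:
  fixes L :: "(int ^ 'd::finite) set"
  assumes "finite \<E>" "\<And>E. E \<in> \<E> \<Longrightarrow> subspace E \<and> \<not> real_vec ` L \<subseteq> E"
    and zero: "0 \<in> L" and add: "\<And>u v. u \<in> L \<Longrightarrow> v \<in> L \<Longrightarrow> u + v \<in> L"
  shows "\<exists>u\<in>L. \<forall>E\<in>\<E>. real_vec u \<notin> E"
  using assms(1,2)
proof (induction \<E> rule: finite_induct)
  case empty
  then show ?case using zero by blast
next
  case (insert E \<E>)
  then obtain u where u: "u \<in> L" "\<And>F. F \<in> \<E> \<Longrightarrow> real_vec u \<notin> F" by auto
  obtain w where w: "w \<in> L" "real_vec w \<notin> E" using insert.prems[of E] by blast
  have in_L: "u + of_nat n * w \<in> L" for n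
  proof (induction n)
    case (Suc n)
    from add[OF Suc w(1)] show ?case by (simp add: algebra_simps)
  qed (simp add: u(1))
  define bad where "bad F = {n. real_vec (u + of_nat n * w) \<in> F}" for F
  have "finite (bad F)" if F: "F \<in> insert E \<E>" for F
  proof -
    have F': "subspace F" using insert.prems F by blast
    have "m = n" if "m \<in> bad F" "n \<in> bad F" for m n
    proof (rule ccontr)
      assume "m \<noteq> n"
      have "real_vec (u + of_nat m * w) - real_vec (u + of_nat n * w) \<in> F"
        using that F' by (intro subspace_diff) (simp_all add: bad_def)
      then have "(real m - real n) *\<^sub>R real_vec w \<in> F" by (simp add: scaleR_diff_left)
      then have "(1 / (real m - real n)) *\<^sub>R (real m - real n) *\<^sub>R real_vec w \<in> F"
        by (rule subspace_scale[OF F'])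
      then have "real_vec w \<in> F" using \<open>m \<noteq> n\<close> by simp
      then have "of_nat n *\<^sub>R real_vec w \<in> F" by (rule subspace_scale[OF F'])
      moreover have "real_vec (u + of_nat n * w) \<in> F" using that by (simp add: bad_def)
      ultimately have "real_vec (u + of_nat n * w) - of_nat n *\<^sub>R real_vec w \<in> F"
        by (intro subspace_diff[OF F'])
      then have "real_vec u \<in> F" by simp
      with \<open>real_vec w \<in> F\<close> w(2) u(2) F show False by blast
    qed
    then have "\<exists>n. bad F \<subseteq> {n}" by blast
    then show ?thesis using finite_subset by blast
  qed
  then have "finite (\<Union>F\<in>insert E \<E>. bad F)" using insert.hyps(1) by blast
  then obtain n where "n \<notin> (\<Union>F\<in>insert E \<E>. bad F)" using ex_new_if_finite infinite_UNIV_nat by blast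
  then show ?case using in_L[of n] by (intro bexI[of _ "u + of_nat n * w"]) (auto simp: bad_def)
qed

text \<open>
  Each vector avoids the spans of all sets of earlier vectors that do not contain its own subspace.
  Such a span of dimension \<open>k\<close> could only be harmful if all the earlier vectors lay in the same
  subspace.
\<close>

lemma exists_general_position:
  fixes W :: "nat \<Rightarrow> (real ^ 'd::finite) set" and L :: "(real ^ 'd) set \<Rightarrow> (int ^ 'd) set"
  assumes W: "\<And>s. subspace (W s) \<and> dim (W s) = k \<and> W s \<subseteq> span (real_vec ` L (W s)) \<and> real_vec ` L (W s) \<subseteq> W s"
    and fin: "finite (range W)"
    and zero: "\<And>s. 0 \<in> L (W s)" and add: "\<And>s u v. u \<in> L (W s) \<Longrightarrow> v \<in> L (W s) \<Longrightarrow> u + v \<in> L (W s)"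
  obtains x where "\<And>s. x s \<in> L (W s)"
    "\<And>I. finite I \<Longrightarrow> card I \<le> k \<or> card I = Suc k \<and> (\<exists>s\<in>I. \<exists>t\<in>I. W s \<noteq> W t) \<Longrightarrow>
      inj_on x I \<and> independent (real_vec ` x ` I)"
proof -
  let ?P = "\<lambda>f s r. r \<in> L (W s) \<and> (\<forall>t. W t \<noteq> W s \<longrightarrow> real_vec r \<notin> W t) \<and>
    (\<forall>I\<subseteq>{..<s}. \<not> W s \<subseteq> span (real_vec ` f ` I) \<longrightarrow> real_vec r \<notin> span (real_vec ` f ` I))"
  have "\<exists>f. \<forall>s. ?P f s (f s)"
  proof (rule dependent_wellorder_choice)
    fix r :: "int ^ 'd" and f g :: "nat \<Rightarrow> int ^ 'd" and s
    assume "\<And>t. t < s \<Longrightarrow> f t = g t"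
    then have "f ` I = g ` I" if "I \<subseteq> {..<s}" for I using that by (intro image_cong) auto
    then show "?P f s r = ?P g s r" by auto
  next
    fix s and f :: "nat \<Rightarrow> int ^ 'd"
    define \<E> where "\<E> = {E \<in> range W \<union> (\<lambda>I. span (real_vec ` f ` I)) ` Pow {..<s}. \<not> W s \<subseteq> E}"
    have "\<exists>u\<in>L (W s). \<forall>E\<in>\<E>. real_vec u \<notin> E"
    proof (rule exists_avoiding_subspaces)
      show "finite \<E>" using fin by (simp add: \<E>_def)
      fix E assume E: "E \<in> \<E>"
      then have "subspace E" using W by (auto simp: \<E>_def)
      moreover have "\<not> real_vec ` L (W s) \<subseteq> E"
      proof
        assume "real_vec ` L (W s) \<subseteq> E"
        then have "span (real_vec ` L (W s)) \<subseteq> E" using \<open>subspace E\<close> by (rule span_minimal)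
        with W[of s] E show False by (auto simp: \<E>_def)
      qed
      ultimately show "subspace E \<and> \<not> real_vec ` L (W s) \<subseteq> E" by blast
    qed (use zero add in auto)
    then obtain u where u: "u \<in> L (W s)" "\<And>E. E \<in> \<E> \<Longrightarrow> real_vec u \<notin> E" by blast
    have "real_vec u \<notin> W t" if "W t \<noteq> W s" for t
    proof -
      have "\<not> W s \<subseteq> W t" using that W subspace_dim_equal[of "W s" "W t"] by auto
      then show ?thesis using u(2)[of "W t"] by (simp add: \<E>_def)
    qed
    moreover have "real_vec u \<notin> span (real_vec ` f ` I)"
      if "I \<subseteq> {..<s}" "\<not> W s \<subseteq> span (real_vec ` f ` I)" for I
      using u(2)[of "span (real_vec ` f ` I)"] that by (auto simp: \<E>_def)
    ultimately show "\<exists>r. ?P f s r" using u(1) by blast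
  qed
  then obtain x where P: "\<forall>s. ?P x s (x s)" by (rule exE)
  have x: "\<And>s. x s \<in> L (W s)" "\<And>s t. W t \<noteq> W s \<Longrightarrow> real_vec (x s) \<notin> W t"
    "\<And>s I. I \<subseteq> {..<s} \<Longrightarrow> \<not> W s \<subseteq> span (real_vec ` x ` I) \<Longrightarrow> real_vec (x s) \<notin> span (real_vec ` x ` I)"
    using P[rule_format] by blast+
  have "inj_on x I \<and> independent (real_vec ` x ` I)"
    if "finite I" "card I \<le> k \<or> card I = Suc k \<and> (\<exists>s\<in>I. \<exists>t\<in>I. W s \<noteq> W t)" for I
    using that
  proof (induction I rule: finite_linorder_max_induct)
    case empty
    then show ?case by (simp add: independent_empty)
  next
    case (insert s I)
    have s: "s \<notin> I" using insert.hyps by blast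
    then have card: "card (insert s I) = Suc (card I)" using insert.hyps(1) by simp
    with insert.prems have "card I \<le> k" by auto
    with insert.IH have IH: "inj_on x I" "independent (real_vec ` x ` I)" by blast+
    have card_image: "card (real_vec ` x ` I) = card I"
      using IH(1) by (simp add: card_image inj_on_def)
    \<comment> \<open>Otherwise a dimension count gives \<open>card I = k\<close> and equality of
      both spaces. Then all earlier vectors lie in \<open>W s\<close>, but some of them belongs to
      another subspace and was chosen outside \<open>W s\<close>.\<close>
    have "\<not> W s \<subseteq> span (real_vec ` x ` I)"
    proof
      assume sub: "W s \<subseteq> span (real_vec ` x ` I)"
      have dim: "dim (span (real_vec ` x ` I)) = card I"
        using IH(2) card_image by (simp add: dim_eq_card_independent)
      with sub W[of s] have "k \<le> card I" by (metis dim_subset)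
      with card insert.prems have "card I = k" "\<exists>s'\<in>insert s I. \<exists>t\<in>insert s I. W s' \<noteq> W t" by auto
      then obtain t where t: "t \<in> I" "W t \<noteq> W s" by (metis insert_iff)
      have "W s = span (real_vec ` x ` I)"
        using sub W[of s] dim \<open>card I = k\<close> by (intro subspace_dim_equal) auto
      then have "real_vec (x t) \<in> W s" using t(1) by (simp add: span_base)
      with x(2)[of s t] t(2) show False by auto
    qed
    moreover have "I \<subseteq> {..<s}" using insert.hyps by auto
    ultimately have "real_vec (x s) \<notin> span (real_vec ` x ` I)" by (intro x(3))
    moreover from this have "x s \<notin> x ` I"
      using span_base[of "real_vec (x s)" "real_vec ` x ` I"] by auto
    ultimately show ?case using IH s by (simp add: independent_insertI)
  qed
  with x(1) show ?thesis using that by blast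
qed

section \<open>Decomposition along transversals\<close>

definition independent_list :: "(int ^ 'd::finite) list \<Rightarrow> bool" where
  "independent_list xs \<longleftrightarrow> distinct xs \<and> independent (real_vec ` set xs)"

lemma independent_list_subset:
  "independent_list xs \<Longrightarrow> distinct ys \<Longrightarrow> set ys \<subseteq> set xs \<Longrightarrow> independent_list ys"
  unfolding independent_list_def by (meson image_mono independent_mono)

lemma independent_list_Cons_not_span:
  assumes "independent_list (v # P)"
  shows "real_vec v \<notin> span (real_vec ` set P)"
proof -
  have "real_vec v \<notin> real_vec ` set P" "independent (insert (real_vec v) (real_vec ` set P))"
    using assms by (auto simp: independent_list_def)
  then show ?thesis by (simp add: independent_insert)
qed

text \<open>\<open>P\<close> collects the vectors already picked for a transversal,
  \<open>Hs\<close> the products still to be split.\<close>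

definition in_ker :: "(int ^ 'd::finite) list \<Rightarrow> (int ^ 'd) list list \<Rightarrow> (int ^ 'd \<Rightarrow> int) \<Rightarrow> bool" where
  "in_ker P Hs c \<longleftrightarrow> (\<forall>p\<in>set P. fdiff p c = (\<lambda>u. 0)) \<and> (\<forall>h\<in>set Hs. fdiffs h c = (\<lambda>u. 0))"

lemma in_ker_Nil: "in_ker P [] c \<longleftrightarrow> (\<forall>p\<in>set P. fdiff p c = (\<lambda>u. 0))"
  by (simp add: in_ker_def)

lemma in_ker_Cons: "in_ker P (h # Hs) c \<longleftrightarrow> fdiffs h c = (\<lambda>u. 0) \<and> in_ker P Hs c"
  by (auto simp: in_ker_def)

lemma in_ker_period: "in_ker (p # P) Hs c \<longleftrightarrow> fdiff p c = (\<lambda>u. 0) \<and> in_ker P Hs c"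
  by (auto simp: in_ker_def)

lemma in_ker_fdiff: "in_ker P Hs c \<Longrightarrow> in_ker P Hs (fdiff v c)"
  by (simp add: in_ker_def fdiffs_fdiff) (metis fdiff_commute fdiff_0)

lemma in_ker_fdiffs: "in_ker P Hs c \<Longrightarrow> in_ker P Hs (fdiffs vs c)"
  by (induction vs) (simp_all add: in_ker_fdiff)

lemma in_ker_add: "in_ker P Hs a \<Longrightarrow> in_ker P Hs b \<Longrightarrow> in_ker P Hs (\<lambda>u. a u + b u)"
  by (simp add: in_ker_def fdiff_add fdiffs_add)

lemma in_ker_diff: "in_ker P Hs a \<Longrightarrow> in_ker P Hs b \<Longrightarrow> in_ker P Hs (\<lambda>u. a u - b u)"
  by (simp add: in_ker_def fdiff_diff fdiffs_diff)

text \<open>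
  Sum \<open>z\<close> along the direction \<open>v\<close>, starting from the slab \<open>0 \<le> \<phi> < 1\<close> of a linear functional
  \<open>\<phi>\<close> that vanishes on the periods and has \<open>\<phi> v = 1\<close>.
\<close>

lemma exists_periodic_fdiff_eq:
  assumes v: "real_vec v \<notin> span (real_vec ` set P)"
    and z: "\<And>p. p \<in> set P \<Longrightarrow> is_period z p"
  shows "\<exists>y. (\<forall>p\<in>set P. is_period y p) \<and> fdiff v y = z"
proof -
  \<comment> \<open>The component \<open>a\<close> of \<open>real_vec v\<close> orthogonal to the
    periods is nonzero; the normalised inner product with it is the functional.\<close>
  obtain b a where ab: "b \<in> span (real_vec ` set P)" "\<And>w. w \<in> span (real_vec ` set P) \<Longrightarrow> orthogonal a w"
    "real_vec v = b + a"
    using orthogonal_subspace_decomp_exists by blast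
  have "a \<noteq> 0" using ab(1,3) v by auto
  have av: "a \<bullet> real_vec v = a \<bullet> a" using ab by (simp add: inner_add_right orthogonal_def)
  define \<phi> where "\<phi> u = (a \<bullet> real_vec u) / (a \<bullet> a)" for u
  have \<phi>v: "\<phi> (u - v) = \<phi> u - 1" for u
    using \<open>a \<noteq> 0\<close> by (simp add: \<phi>_def inner_diff_right av diff_divide_distrib)
  have \<phi>p: "\<phi> (u + p) = \<phi> u" if "p \<in> set P" for u p
    using ab(2)[of "real_vec p"] that by (simp add: \<phi>_def inner_add_right orthogonal_def span_base)
  define n where "n u = \<lfloor>\<phi> u\<rfloor>" for u
  have nv: "n (u - v) = n u - 1" for u by (simp add: n_def \<phi>v)
  \<comment> \<open>Both sums are empty when \<open>n u = -1\<close>. Below that slab the terms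
    start at \<open>i = 1\<close>, because going from \<open>u + v\<close> back to \<open>u\<close>
    subtracts \<open>z (u + v)\<close>.\<close>
  define y where "y u = (\<Sum>i<nat (n u + 1). z (u - of_nat i * v)) - (\<Sum>i=1..<nat (- n u). z (u + of_nat i * v))" for u
  have "is_period y p" if p: "p \<in> set P" for p
  proof -
    have "n (u + p) = n u" for u by (simp add: n_def \<phi>p[OF p])
    moreover have "z (u + p - w) = z (u - w)" "z (u + p + w) = z (u + w)" for u w
      using z[OF p] unfolding is_period_def by (metis add_diff_eq add.commute add.assoc diff_add_eq)+
    ultimately show ?thesis by (simp add: is_period_def y_def)
  qed
  moreover have "fdiff v y u = z u" for u
  proof (cases "n u \<ge> 0")
    case True
    then obtain m where m: "n u = int m" using nonneg_int_cases by blast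
    have "(\<Sum>i<Suc m. z (u - of_nat i * v)) = z u + (\<Sum>i<m. z (u - v - of_nat i * v))"
      by (simp add: sum.lessThan_Suc_shift algebra_simps del: sum.lessThan_Suc)
    moreover have "nat (int m + 1) = Suc m" by simp
    ultimately show ?thesis by (simp add: fdiff_def y_def nv m del: sum.lessThan_Suc)
  next
    case False
    define m where "m = nat (- n u)"
    have m: "n u = - int m" "m > 0" using False by (simp_all add: m_def)
    have "(\<Sum>i=1..<Suc m. z (u - v + of_nat i * v)) = (\<Sum>i=0..<m. z (u + of_nat i * v))"
      using sum.shift_bounds_Suc_ivl[of "\<lambda>i. z (u - v + of_nat i * v)" 0 m] by (simp add: algebra_simps)
    also have "\<dots> = z u + (\<Sum>i=1..<m. z (u + of_nat i * v))"
      using m(2) by (simp add: sum.atLeast_Suc_lessThan)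
    finally have "(\<Sum>i=1..<Suc m. z (u - v + of_nat i * v)) = z u + (\<Sum>i=1..<m. z (u + of_nat i * v))" .
    moreover have "nat (1 + int m) = Suc m" "nat (1 - int m) = 0" "nat (- int m) = 0" using m(2) by auto
    ultimately show ?thesis by (simp add: fdiff_def y_def nv m(1) del: sum.op_ivl_Suc)
  qed
  ultimately show ?thesis by blast
qed

text \<open>Outer induction on the products, inner induction on the factors of the first one. For a
  first factor \<open>u\<close>, solve for \<open>fdiff u z\<close> with the shorter product, lift
  the solution \<open>y1\<close> through \<open>fdiff u\<close>, and correct the error, which has
  period \<open>u\<close> and so moves \<open>u\<close> into \<open>P\<close>.\<close>

lemma exists_in_ker_fdiff_eq:
  assumes "\<And>t. t \<in> listset (map set Hs) \<Longrightarrow> independent_list (v # P @ t)"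
    and "in_ker P Hs z"
  shows "\<exists>y. in_ker P Hs y \<and> fdiff v y = z"
  using assms
proof (induction Hs arbitrary: P v z)
  case Nil
  from Nil.prems(1)[of "[]"] have "real_vec v \<notin> span (real_vec ` set P)"
    by (simp add: independent_list_Cons_not_span)
  from exists_periodic_fdiff_eq[OF this, of z] Nil.prems(2) show ?case
    by (simp add: in_ker_Nil fdiff_eq_0_iff)
next
  case (Cons h Hs)
  show ?case
    using Cons.prems
  proof (induction h arbitrary: z)
    case Nil
    then have "z = (\<lambda>u. 0)" by (simp add: in_ker_Cons)
    with Nil.prems(2) show ?case by (intro exI[of _ z]) simp
  next
    case (Cons u h)
    note IH = \<open>\<And>P v z. (\<And>t. t \<in> listset (map set Hs) \<Longrightarrow> independent_list (v # P @ t)) \<Longrightarrow>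
      in_ker P Hs z \<Longrightarrow> \<exists>y. in_ker P Hs y \<and> fdiff v y = z\<close>
    have ind: "independent_list (v # P @ u # t)" if "t \<in> listset (map set Hs)" for t
      using Cons.prems(1)[of "u # t"] that by (simp add: set_Cons_def)
    have ind1: "independent_list (u # P @ t)" if "t \<in> listset (map set Hs)" for t
      by (rule independent_list_subset[OF ind[OF that]]) (use ind[OF that] in \<open>auto simp: independent_list_def\<close>)
    have ind2: "independent_list (v # (u # P) @ t)" if "t \<in> listset (map set Hs)" for t
      by (rule independent_list_subset[OF ind[OF that]]) (use ind[OF that] in \<open>auto simp: independent_list_def\<close>)
    have z: "fdiff u (fdiffs h z) = (\<lambda>u. 0)" "in_ker P Hs z"
      using Cons.prems(2) by (simp_all add: in_ker_Cons)
    have "in_ker P (h # Hs) (fdiff u z)"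
      using z by (simp add: in_ker_Cons fdiffs_fdiff in_ker_fdiff)
    moreover have "independent_list (v # P @ t)" if "t \<in> listset (map set (h # Hs))" for t
      using Cons.prems(1)[of t] that by (auto simp: set_Cons_def)
    ultimately obtain y1 where y1: "in_ker P (h # Hs) y1" "fdiff v y1 = fdiff u z"
      using Cons.IH[of "fdiff u z"] by blast
    then have "in_ker P Hs y1" by (simp add: in_ker_Cons)
    \<comment> \<open>Here \<open>u\<close> takes the role of \<open>v\<close>, and the product
      \<open>h\<close> is dropped.\<close>
    from IH[OF ind1 this] obtain y where y: "in_ker P Hs y" "fdiff u y = y1" by blast
    define z2 where "z2 = (\<lambda>x. z x - fdiff v y x)"
    have "in_ker P Hs z2"
      unfolding z2_def using z(2) y(1) by (intro in_ker_diff in_ker_fdiff)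
    moreover have "fdiff u z2 = (\<lambda>u. 0)"
      unfolding z2_def fdiff_diff fdiff_commute[of u v] y(2) y1(2) by simp
    ultimately have "in_ker (u # P) Hs z2" by (simp add: in_ker_period)
    from IH[OF ind2 this] obtain y2 where y2: "in_ker (u # P) Hs y2" "fdiff v y2 = z2" by blast
    have "in_ker P ((u # h) # Hs) y"
      using y y1(1) by (simp add: in_ker_Cons flip: fdiffs_fdiff)
    moreover have "in_ker P ((u # h) # Hs) y2"
      using y2(1) by (simp add: in_ker_Cons in_ker_period flip: fdiffs_fdiff)
    ultimately have "in_ker P ((u # h) # Hs) (\<lambda>x. y x + y2 x)" by (rule in_ker_add)
    moreover have "fdiff v (\<lambda>x. y x + y2 x) = z"
      by (simp add: fdiff_add y2(2) z2_def)
    ultimately show ?case by blast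
  qed
qed

lemma exists_in_ker_fdiffs_eq:
  assumes "\<And>w t. w \<in> set ws \<Longrightarrow> t \<in> listset (map set Hs) \<Longrightarrow> independent_list (w # P @ t)"
    and "in_ker P Hs z"
  shows "\<exists>y. in_ker P Hs y \<and> fdiffs ws y = z"
  using assms
proof (induction ws arbitrary: z)
  case Nil
  then show ?case by auto
next
  case (Cons w ws)
  then obtain y where y: "in_ker P Hs y" "fdiff w y = z"
    using exists_in_ker_fdiff_eq[of Hs w P z] by auto
  with Cons obtain x where "in_ker P Hs x" "fdiffs ws x = y" by (metis list.set_intros(2))
  with y(2) show ?case by (intro exI[of _ x]) simp
qed

text \<open>Factors are split off in list order. With \<open>u\<close> made a period, equations for
  every later factor \<open>w\<close> must remain solvable, and the same is required of the
  remaining products.\<close>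

fun separated :: "(int ^ 'd::finite) list \<Rightarrow> (int ^ 'd) list list \<Rightarrow> bool" where
  "separated P [] \<longleftrightarrow> True"
| "separated P (h # Hs) \<longleftrightarrow>
    sorted_wrt (\<lambda>u w. \<forall>t\<in>listset (map set Hs). independent_list (w # u # P @ t)) h \<and>
    (\<forall>u\<in>set h. separated (u # P) Hs)"

text \<open>For a product \<open>u # h\<close>, choose \<open>y\<close> with period \<open>u\<close>
  and the same image as \<open>z\<close> under \<open>fdiffs h\<close>. Then \<open>y\<close> is
  decomposed with \<open>u\<close> in the transversal, and \<open>z - y\<close> is annihilated by
  the shorter product \<open>h\<close>.\<close>

lemma separated_decomposition:
  assumes "separated P Hs" "in_ker P Hs z"
  shows "\<exists>ys. z = (\<lambda>x. \<Sum>y\<leftarrow>ys. y x) \<and>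
    (\<forall>y\<in>set ys. \<exists>t\<in>listset (map set Hs). \<forall>p\<in>set P \<union> set t. is_period y p)"
  using assms
proof (induction Hs arbitrary: P z)
  case Nil
  then show ?case by (intro exI[of _ "[z]"]) (simp add: in_ker_Nil fdiff_eq_0_iff)
next
  case (Cons h Hs)
  show ?case
    using Cons.prems
  proof (induction h arbitrary: z)
    case Nil
    then show ?case by (intro exI[of _ "[]"]) (simp add: in_ker_Cons)
  next
    case (Cons u h)
    note IH = \<open>\<And>P z. separated P Hs \<Longrightarrow> in_ker P Hs z \<Longrightarrow> \<exists>ys. z = (\<lambda>x. \<Sum>y\<leftarrow>ys. y x) \<and>
      (\<forall>y\<in>set ys. \<exists>t\<in>listset (map set Hs). \<forall>p\<in>set P \<union> set t. is_period y p)\<close>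
    have z: "fdiff u (fdiffs h z) = (\<lambda>u. 0)" "in_ker P Hs z"
      using Cons.prems(2) by (simp_all add: in_ker_Cons)
    then have "in_ker (u # P) Hs (fdiffs h z)" by (simp add: in_ker_period in_ker_fdiffs)
    moreover have "independent_list (w # (u # P) @ t)" if "w \<in> set h" "t \<in> listset (map set Hs)" for w t
      using Cons.prems(1) that by simp
    ultimately obtain y where y: "in_ker (u # P) Hs y" "fdiffs h y = fdiffs h z"
      using exists_in_ker_fdiffs_eq[of h Hs "u # P" "fdiffs h z"] by blast
    have "separated (u # P) Hs" using Cons.prems(1) by simp
    from IH[OF this y(1)] obtain ys1 where ys1: "y = (\<lambda>x. \<Sum>y\<leftarrow>ys1. y x)"
      "\<And>y. y \<in> set ys1 \<Longrightarrow> \<exists>t\<in>listset (map set Hs). \<forall>p\<in>set (u # P) \<union> set t. is_period y p" by blast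
    have "separated P (h # Hs)" using Cons.prems(1) by simp
    moreover have "in_ker P (h # Hs) (\<lambda>x. z x - y x)"
      using y z(2) by (simp add: in_ker_Cons in_ker_period in_ker_diff fdiffs_diff)
    ultimately obtain ys2 where ys2: "(\<lambda>x. z x - y x) = (\<lambda>x. \<Sum>y\<leftarrow>ys2. y x)"
      "\<And>y. y \<in> set ys2 \<Longrightarrow> \<exists>t\<in>listset (map set (h # Hs)). \<forall>p\<in>set P \<union> set t. is_period y p"
      using Cons.IH[of "\<lambda>x. z x - y x"] by blast
    have "z x = (\<Sum>y\<leftarrow>ys1 @ ys2. y x)" for x
      using fun_cong[OF ys1(1), of x] fun_cong[OF ys2(1), of x] by simp
    moreover have "\<exists>t\<in>listset (map set ((u # h) # Hs)). \<forall>p\<in>set P \<union> set t. is_period y p"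
      if "y \<in> set (ys1 @ ys2)" for y
    proof (cases "y \<in> set ys1")
      case True
      from ys1(2)[OF this] obtain t where t: "t \<in> listset (map set Hs)"
        "\<forall>p\<in>set (u # P) \<union> set t. is_period y p" by blast
      then show ?thesis by (intro bexI[of _ "u # t"]) (auto simp: set_Cons_def)
    next
      case False
      with that ys2(2) show ?thesis by (fastforce simp: set_Cons_def)
    qed
    ultimately show ?case by blast
  qed
qed

section \<open>Products formed from consecutive blocks\<close>

lemma kills_imp_fdiffs: "kills Gs c \<Longrightarrow> list_all2 (\<lambda>v G. v \<in> G) vs Gs \<Longrightarrow> fdiffs vs c = (\<lambda>u. 0)"
proof (induction Gs arbitrary: vs c)
  case (Cons G Gs)
  from Cons.prems(2) obtain v ws where vs: "vs = v # ws" "v \<in> G" "list_all2 (\<lambda>v G. v \<in> G) ws Gs"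
    by (auto simp: list_all2_Cons2)
  with Cons.prems(1) Cons.IH[of "fdiff v c" ws] show ?case by (simp add: fdiffs_fdiff)
qed simp

text \<open>Its indices run once through the residues modulo \<open>m\<close>, so with cyclic
  indexing a block holds one vector from each of \<open>m\<close> lattices.\<close>

definition block :: "(nat \<Rightarrow> 'a) \<Rightarrow> nat \<Rightarrow> nat \<Rightarrow> 'a list" where
  "block x m i = map x [i * m..<i * m + m]"

lemma listset_blocks:
  assumes "a \<le> b" "t \<in> listset (map set (map (block x m) [a..<b]))"
  shows "\<exists>ts. t = map x ts \<and> distinct ts \<and> set ts \<subseteq> {a * m..<b * m} \<and> length ts = b - a"
  using assms
proof (induction a arbitrary: t rule: inc_induct)
  case base
  then show ?case by simp
next
  case (step a)
  then have "[a..<b] = a # [Suc a..<b]" by (simp add: upt_conv_Cons)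
  with step.prems obtain v t' where t: "t = v # t'" "v \<in> set (block x m a)"
    "t' \<in> listset (map set (map (block x m) [Suc a..<b]))" by (auto simp: set_Cons_def)
  from step.IH[OF t(3)] obtain ts where ts: "t' = map x ts" "distinct ts"
    "set ts \<subseteq> {Suc a * m..<b * m}" "length ts = b - Suc a" by blast
  from t(2) obtain s where s: "v = x s" "a * m \<le> s" "s < a * m + m" by (auto simp: block_def)
  have "Suc a * m \<le> b * m" using step.hyps by (intro mult_le_mono1) simp
  then have "set (s # ts) \<subseteq> {a * m..<b * m}" using ts(3) s by auto
  moreover have "s \<notin> set ts" using ts(3) s by auto
  ultimately show ?case using step.hyps t(1) ts s(1) by (intro exI[of _ "s # ts"]) simp
qed

text \<open>The list \<open>js\<close> holds one index from each earlier block. Two indices of the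
  current block differ modulo \<open>m\<close>; with \<open>js\<close> and a transversal of the
  later blocks they make \<open>Suc k\<close> indices that are not all congruent.\<close>

lemma separated_blocks:
  fixes x :: "nat \<Rightarrow> int ^ 'd::finite"
  assumes sep: "\<And>js s s'. distinct js \<Longrightarrow> length js = Suc k \<Longrightarrow> s \<in> set js \<Longrightarrow> s' \<in> set js \<Longrightarrow> s mod m \<noteq> s' mod m \<Longrightarrow>
      independent_list (map x js)"
    and "a \<le> k" "distinct js" "set js \<subseteq> {..<a * m}" "length js = a"
  shows "separated (map x js) (map (block x m) [a..<k])"
  using assms(2-)
proof (induction a arbitrary: js rule: inc_induct)
  case base
  then show ?case by simp
next
  case (step a)
  then have upt: "[a..<k] = a # [Suc a..<k]" by (simp add: upt_conv_Cons)
  have "sorted_wrt (\<lambda>s s'. \<forall>t\<in>listset (map set (map (block x m) [Suc a..<k])).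
      independent_list (x s' # x s # map x js @ t)) [a * m..<a * m + m]"
  proof (rule sorted_wrt_mono_rel[OF _ sorted_wrt_upt], rule ballI)
    fix s s' t
    assume s: "s \<in> set [a * m..<a * m + m]" "s' \<in> set [a * m..<a * m + m]" "s < s'"
      and t: "t \<in> listset (map set (map (block x m) [Suc a..<k]))"
    have "Suc a \<le> k" using step.hyps by simp
    from listset_blocks[OF this t] obtain ts where ts: "t = map x ts" "distinct ts"
      "set ts \<subseteq> {Suc a * m..<k * m}" "length ts = k - Suc a" by blast
    have "s mod m \<noteq> s' mod m"
    proof
      assume "s mod m = s' mod m"
      then have "m dvd s' - s" using s(3) mod_eq_dvd_iff_nat[of s s' m] by simp
      then have "m \<le> s' - s" using s(3) by (intro dvd_imp_le) simp_all
      with s show False by simp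
    qed
    moreover have "distinct (s' # s # js @ ts)"
    proof -
      have "set js \<inter> set ts = {}" "s \<notin> set js" "s' \<notin> set js" "s \<notin> set ts" "s' \<notin> set ts"
        using s step.prems(2) ts(3) by fastforce+
      then show ?thesis using s(3) step.prems(1) ts(2) by simp
    qed
    moreover have "length (s' # s # js @ ts) = Suc k"
      using step.hyps step.prems(3) ts(4) by simp
    ultimately have "independent_list (map x (s' # s # js @ ts))"
      by (intro sep[of _ s s']) auto
    then show "independent_list (x s' # x s # map x js @ t)" by (simp add: ts(1))
  qed
  moreover have "separated (map x (s # js)) (map (block x m) [Suc a..<k])"
    if s: "s \<in> set [a * m..<a * m + m]" for s
    by (rule step.IH) (use s step.prems in \<open>fastforce+\<close>)
  ultimately show ?case by (auto simp: upt block_def[of x m a] sorted_wrt_map)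
qed

lemma k_periodic_decomposition:
  fixes c :: "int ^ 'd::finite \<Rightarrow> int"
  assumes kills: "kills (map L Ws) c" and "distinct Ws" "Ws \<noteq> []"
    and Ws: "\<And>W. W \<in> set Ws \<Longrightarrow> subspace W \<and> dim W = k \<and> W \<subseteq> span (real_vec ` L W) \<and> real_vec ` L W \<subseteq> W"
    and zero: "\<And>W. W \<in> set Ws \<Longrightarrow> 0 \<in> L W"
    and add: "\<And>W u v. W \<in> set Ws \<Longrightarrow> u \<in> L W \<Longrightarrow> v \<in> L W \<Longrightarrow> u + v \<in> L W"
  shows "\<exists>ys. c = (\<lambda>u. \<Sum>y\<leftarrow>ys. y u) \<and> (\<forall>y\<in>set ys. k_periodic k y)"
proof -
  define m where "m = length Ws"
  have "m > 0" using assms(3) by (simp add: m_def)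
  \<comment> \<open>The subspaces are repeated cyclically, so that one infinite sequence in general
    position supplies all blocks.\<close>
  define W where "W s = Ws ! (s mod m)" for s
  have W_in: "W s \<in> set Ws" for s using \<open>m > 0\<close> by (simp add: W_def m_def)
  have "range W \<subseteq> set Ws" using W_in by auto
  then have "finite (range W)" by (rule finite_subset) simp
  from exists_general_position[of W k L, OF Ws[OF W_in] this zero[OF W_in] add[OF W_in]]
  obtain x where x: "\<And>s. x s \<in> L (W s)"
    "\<And>I. finite I \<Longrightarrow> card I \<le> k \<or> card I = Suc k \<and> (\<exists>s\<in>I. \<exists>t\<in>I. W s \<noteq> W t) \<Longrightarrow>
      inj_on x I \<and> independent (real_vec ` x ` I)" by blast
  have W_eq: "W s = W t \<longleftrightarrow> s mod m = t mod m" for s t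
    using \<open>m > 0\<close> assms(2) by (simp add: W_def m_def nth_eq_iff_index_eq)
  have ind: "independent_list (map x js)"
    if "distinct js" "length js \<le> k \<or> length js = Suc k \<and> (\<exists>s\<in>set js. \<exists>t\<in>set js. W s \<noteq> W t)" for js
    using x(2)[of "set js"] that by (simp add: independent_list_def distinct_map distinct_card)
  have "separated [] (map (block x m) [0..<k])"
    using separated_blocks[where x = x and k = k and m = m and a = 0 and js = "[]"] ind W_eq by auto
  moreover have "in_ker [] (map (block x m) [0..<k]) c"
  proof -
    have "fdiffs (block x m i) c = (\<lambda>u. 0)" for i
    proof (rule kills_imp_fdiffs[OF kills])
      have "x (i * m + j) \<in> L (Ws ! j)" if "j < m" for j
        using x(1)[of "i * m + j"] that by (simp add: W_def)
      then show "list_all2 (\<lambda>v G. v \<in> G) (block x m i) (map L Ws)"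
        by (simp add: list_all2_conv_all_nth block_def m_def)
    qed
    then show ?thesis by (simp add: in_ker_def)
  qed
  ultimately obtain ys where ys: "c = (\<lambda>u. \<Sum>y\<leftarrow>ys. y u)"
    "\<And>y. y \<in> set ys \<Longrightarrow> \<exists>t\<in>listset (map set (map (block x m) [0..<k])). \<forall>p\<in>set [] \<union> set t. is_period y p"
    using separated_decomposition[of "[]" "map (block x m) [0..<k]" c] by blast
  have "k_periodic k y" if "y \<in> set ys" for y
  proof -
    from ys(2)[OF that] obtain t where t: "t \<in> listset (map set (map (block x m) [0..<k]))"
      "\<forall>p\<in>set t. is_period y p" by auto
    \<comment> \<open>One index from each of \<open>k\<close> blocks gives \<open>k\<close> distinct
      indices, few enough to be independent without a condition on residues.\<close>
    from listset_blocks[OF le0 t(1)] obtain ts where ts: "t = map x ts" "distinct ts" "length ts = k" by auto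
    have "independent_list t" unfolding ts(1) using ts by (intro ind) simp_all
    then have "card (set t) = k" "independent (real_vec ` set t)"
      using distinct_card[of t] ts(1,3) by (simp_all add: independent_list_def)
    with t(2) show ?thesis unfolding k_periodic_def by (intro exI[of _ "set t"]) simp
  qed
  with ys(1) show ?thesis by blast
qed

section \<open>Assembly of the decomposition\<close>

theorem theorem3:
  fixes c :: "int ^ 'd::finite \<Rightarrow> int" and k :: nat
  assumes "configuration c"
    and "k \<in> {1..CARD('d)}"
    and "\<And>V :: (real ^ 'd) set. subspace V \<Longrightarrow> dim V = k - 1 \<Longrightarrow>
           \<exists>f :: 'd laurent_poly. periodizer f c \<and> real_vec ` Poly_Mapping.keys f \<inter> V = {0}"
  shows "\<exists>(m::nat) (cs :: nat \<Rightarrow> int ^ 'd \<Rightarrow> int).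
           (\<forall>i\<in>{1..m}. k_periodic k (cs i)) \<and> c = (\<lambda>u. \<Sum>i=1..m. cs i u)"
proof -
  have ann: "\<exists>vs. (\<forall>v\<in>set vs. real_vec v \<notin> V) \<and> fdiffs vs c = (\<lambda>u. 0)"
    if V: "subspace V" "dim V = k - 1" for V
  proof -
    from assms(3)[OF V] obtain f where f: "periodizer f c" "real_vec ` Poly_Mapping.keys f \<inter> V = {0}" by blast
    have "dim V < CARD('d)" using V(2) assms(2) by auto
    with assms(1) f V(1) show ?thesis by (rule annihilating_fdiffs)
  qed
  have "k \<le> CARD('d)" using assms(2) by simp
  from exists_kills_independent[OF ann this order_refl]
  obtain Gs where Gs: "kills Gs c" "\<And>G. G \<in> set Gs \<Longrightarrow> finite G \<and> card G = k \<and> independent (real_vec ` G)"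
    by blast
  from exists_kills_lattices[OF configuration_bounded[OF assms(1)] Gs]
  obtain Ws L where Ws: "distinct Ws" "kills (map L Ws) c"
    "\<And>W. W \<in> set Ws \<Longrightarrow> subspace W \<and> dim W = k \<and> W \<subseteq> span (real_vec ` L W) \<and> real_vec ` L W \<subseteq> W"
    "\<And>W. W \<in> set Ws \<Longrightarrow> 0 \<in> L W"
    "\<And>W u v. W \<in> set Ws \<Longrightarrow> u \<in> L W \<Longrightarrow> v \<in> L W \<Longrightarrow> u + v \<in> L W"
    by blast
  have "\<exists>ys. c = (\<lambda>u. \<Sum>y\<leftarrow>ys. y u) \<and> (\<forall>y\<in>set ys. k_periodic k y)"
  proof (cases "Ws = []")
    \<comment> \<open>With no lattices, \<open>kills [] c\<close> says that \<open>c\<close> is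
      zero, the empty sum; the cyclic indexing in the other case needs at least one lattice.\<close>
    case True
    with Ws(2) show ?thesis by (intro exI[of _ "[]"]) simp
  next
    case False
    with Ws show ?thesis by (intro k_periodic_decomposition)
  qed
  then obtain ys where ys: "c = (\<lambda>u. \<Sum>y\<leftarrow>ys. y u)" "\<And>y. y \<in> set ys \<Longrightarrow> k_periodic k y" by blast
  have "(\<Sum>y\<leftarrow>ys. y u) = (\<Sum>i=1..length ys. (ys ! (i - 1)) u)" for u
  proof -
    have "(\<Sum>y\<leftarrow>ys. y u) = (\<Sum>i=0..<length ys. (ys ! i) u)"
      by (simp add: sum_list_sum_nth)
    also have "\<dots> = (\<Sum>i=Suc 0..<Suc (length ys). (ys ! (i - 1)) u)"
      by (subst sum.shift_bounds_Suc_ivl) simp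
    finally show ?thesis by (simp add: atLeastLessThanSuc_atLeastAtMost del: sum.op_ivl_Suc)
  qed
  moreover have "k_periodic k (ys ! (i - 1))" if "i \<in> {1..length ys}" for i
    using that by (intro ys(2)) auto
  ultimately show ?thesis using ys(1)
    by (intro exI[of _ "length ys"] exI[of _ "\<lambda>i. ys ! (i - 1)"]) simp
qed

end
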